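(* Let $\pi$ be a Borel probability measure on $\mathbb R^d$ with compact support $K$. Then a typical measure $\mu\in\mathcal P(K)$ satisfies $$-q\,\overline D_{\pi,\mathrm{max}}(-\infty)\le\underline{\dim}^{q}_{*,\pi,B}(\mu)\le -q\,\overline D_{\pi,\mathrm{unif,max}}(-\infty)\quad\text{provided } q\ge0,$$ $$-q\,\underline D_{\pi,\mathrm{min}}(+\infty)\le\underline{\dim}^{q}_{*,\pi,B}(\mu)\le -q\,\underline D_{\pi,\mathrm{unif,min}}(+\infty)\quad\text{provided } q\le0.$$
   Context: $\mathcal P(K)$ is the set of Borel probability measures on $K$, endowed with the weak topology. A property holds for a typical measure of $\mathcal P(K)$ if it is satisfied by all elements of some dense $G_\delta$ subset of $\mathcal P(K)$. $B(x,r)$ is the open ball of centre $x$ and radius $r$ in $\mathbb R^d$. For $E\subset K$, $r>0$ and $q\in\mathbb R$ let $$\mathbf N_\pi^q(E,r)=\inf\sum_i\pi\big(B(x_i,r)\big)^q,$$ the infimum being over all at most countable families of balls $(B(x_i,r))_i$ with centres $x_i\in K$ covering $E$. The lower covering multifractal box dimension of $E$ of order $q$ with respect to $\pi$ is $$\underline{\dim}_{\pi,B}^q(E)=\liminf_{r\to0^+}\frac{\log\mathbf N_\pi^q(E,r)}{-\log r}.$$ For $\mu\in\mathcal P(K)$, the small lower multifractal box dimension of $\mu$ of order $q$ with respect to $\pi$ is $$\underline{\dim}^{q}_{*,\pi,B}(\mu)=\inf_{\mu(E)>0}\underline{\dim}_{\pi,B}^q(E),$$ where $E$ ranges over Borel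 subsets of $K$. Define, with values in $[0,+\infty]$, $$\overline D_{\pi,\mathrm{unif,max}}(-\infty)=\sup_{\substack{z\in K\\ \kappa>0}}\ \inf_{\substack{N\ge1,\ y_1,\dots,y_N\in K\cap B(z,\kappa)\\ \rho>0}}\ \limsup_{r\to0^+}\ \inf_{i=1,\dots,N}\frac{\log\big(\inf_{x\in K\cap B(y_i,\rho)}\pi(B(x,r))\big)}{\log r},$$ $$\overline D_{\pi,\mathrm{max}}(-\infty)=\sup_{\substack{y\in K\\ \rho>0}}\ \limsup_{r\to0^+}\frac{\log\inf_{x\in K\cap B(y,\rho)}\pi(B(x,r))}{\log r},$$ $$\underline D_{\pi,\mathrm{unif,min}}(+\infty)=\inf_{\substack{z\in K\\ \kappa>0}}\ \sup_{\substack{N\ge1,\ y_1,\dots,y_N\in K\cap B(z,\kappa)\\ \rho>0}}\ \liminf_{r\to0^+}\ \sup_{i=1,\dots,N}\frac{\log\big(\sup_{x\in K\cap B(y_i,\rho)}\pi(B(x,r))\big)}{\log r},$$ $$\underline D_{\pi,\mathrm{min}}(+\infty)=\inf_{\substack{y\in K\\ \rho>0}}\ \liminf_{r\to0^+}\frac{\log\sup_{x\in K\cap B(y,\rho)}\pi(B(x,r))}{\log r}.$$ Convention: $0\cdot(+\infty)=0$. *)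

theory Defs
  imports "HOL-Probability.Probability"
begin

definition measure_support :: "'a::topological_space measure \<Rightarrow> 'a set" where
  "measure_support M = {x. \<forall>U. open U \<longrightarrow> x \<in> U \<longrightarrow> emeasure M U > 0}"


section \<open>Typical measures\<close>

abbreviation prob_measures :: "'a::topological_space set \<Rightarrow> 'a measure set" where
  "prob_measures K \<equiv> space (prob_algebra (restrict_space borel K))"

text \<open>
  The coarsest topology on the Borel probability measures of a compact set \<open>K\<close> for which
  integration of each continuous real function on \<open>K\<close> is continuous. Boundedness of the test
  functions is automatic since \<open>K\<close> is compact. The choice of the zero function shows that the
  underlying set is all of \<open>prob_measures K\<close>.
\<close>

definition weak_topology :: "'a::topological_space set \<Rightarrow> 'a measure topology" where
  "weak_topology K = topology_generated_by
     {{\<mu> \<in> prob_measures K. (\<integral>x. f x \<partial>\<mu>) \<in> U} | (f :: 'a \<Rightarrow> real) U.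
        continuous_on K f \<and> open U}"

definition typically :: "'b topology \<Rightarrow> ('b \<Rightarrow> bool) \<Rightarrow> bool" where
  "typically T Q \<longleftrightarrow>
     (\<exists>G. gdelta_in T G \<and> T closure_of G = topspace T \<and> (\<forall>\<mu>\<in>G. Q \<mu>))"


section \<open>Multifractal box dimensions\<close>

definition ext_ln :: "ennreal \<Rightarrow> ereal" where
  "ext_ln t = (if t = 0 then -\<infinity> else if t = \<infinity> then \<infinity> else ereal (ln (enn2real t)))"

text \<open>
  At most countable families of balls are indexed by a set \<open>I\<close> of natural numbers. When \<open>K\<close> is
  the support of \<open>\<pi>\<close>, the base of the power is positive.
\<close>

definition covering_moment ::
  "'a::metric_space measure \<Rightarrow> 'a set \<Rightarrow> real \<Rightarrow> 'a set \<Rightarrow> real \<Rightarrow> ennreal" where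
  "covering_moment \<pi> K q E r =
     (INF (I, x) \<in> {(I :: nat set, x :: nat \<Rightarrow> 'a). x ` I \<subseteq> K \<and> E \<subseteq> (\<Union>i\<in>I. ball (x i) r)}.
        \<Sum>\<^sub>\<infinity>i\<in>I. ennreal (measure \<pi> (ball (x i) r) powr q))"

definition lower_box_dim ::
  "'a::metric_space measure \<Rightarrow> 'a set \<Rightarrow> real \<Rightarrow> 'a set \<Rightarrow> ereal" where
  "lower_box_dim \<pi> K q E =
     Liminf (at_right 0) (\<lambda>r. ext_ln (covering_moment \<pi> K q E r) / ereal (- ln r))"

text \<open>For \<open>\<mu> \<in> prob_measures K\<close>, \<open>sets \<mu>\<close> consists of the Borel subsets of \<open>K\<close>.\<close>

definition small_lower_box_dim ::
  "'a::metric_space measure \<Rightarrow> 'a set \<Rightarrow> real \<Rightarrow> 'a measure \<Rightarrow> ereal" where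
  "small_lower_box_dim \<pi> K q \<mu> =
     (INF E \<in> {E \<in> sets \<mu>. emeasure \<mu> E > 0}. lower_box_dim \<pi> K q E)"


section \<open>The bounds\<close>

definition inf_local_exponent ::
  "'a::metric_space measure \<Rightarrow> 'a set \<Rightarrow> 'a \<Rightarrow> real \<Rightarrow> real \<Rightarrow> ereal" where
  "inf_local_exponent \<pi> K y \<rho> r =
     ext_ln (INF x \<in> K \<inter> ball y \<rho>. emeasure \<pi> (ball x r)) / ereal (ln r)"

definition sup_local_exponent ::
  "'a::metric_space measure \<Rightarrow> 'a set \<Rightarrow> 'a \<Rightarrow> real \<Rightarrow> real \<Rightarrow> ereal" where
  "sup_local_exponent \<pi> K y \<rho> r =
     ext_ln (SUP x \<in> K \<inter> ball y \<rho>. emeasure \<pi> (ball x r)) / ereal (ln r)"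

definition finite_configs ::
  "'a::metric_space set \<Rightarrow> 'a \<Rightarrow> real \<Rightarrow> (nat \<times> (nat \<Rightarrow> 'a) \<times> real) set" where
  "finite_configs K z \<kappa> =
     {(N, y, \<rho>). N \<ge> 1 \<and> (\<forall>i\<in>{1..N}. y i \<in> K \<inter> ball z \<kappa>) \<and> \<rho> > 0}"

definition upper_D_unif_max :: "'a::metric_space measure \<Rightarrow> 'a set \<Rightarrow> ereal" where
  "upper_D_unif_max \<pi> K =
     (SUP (z, \<kappa>) \<in> K \<times> {0<..}. INF (N, y, \<rho>) \<in> finite_configs K z \<kappa>.
        Limsup (at_right 0) (\<lambda>r. INF i\<in>{1..N}. inf_local_exponent \<pi> K (y i) \<rho> r))"

definition upper_D_max :: "'a::metric_space measure \<Rightarrow> 'a set \<Rightarrow> ereal" where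
  "upper_D_max \<pi> K =
     (SUP (y, \<rho>) \<in> K \<times> {0<..}. Limsup (at_right 0) (\<lambda>r. inf_local_exponent \<pi> K y \<rho> r))"

definition lower_D_unif_min :: "'a::metric_space measure \<Rightarrow> 'a set \<Rightarrow> ereal" where
  "lower_D_unif_min \<pi> K =
     (INF (z, \<kappa>) \<in> K \<times> {0<..}. SUP (N, y, \<rho>) \<in> finite_configs K z \<kappa>.
        Liminf (at_right 0) (\<lambda>r. SUP i\<in>{1..N}. sup_local_exponent \<pi> K (y i) \<rho> r))"

definition lower_D_min :: "'a::metric_space measure \<Rightarrow> 'a set \<Rightarrow> ereal" where
  "lower_D_min \<pi> K =
     (INF (y, \<rho>) \<in> K \<times> {0<..}. Liminf (at_right 0) (\<lambda>r. sup_local_exponent \<pi> K y \<rho> r))"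

end

theory Submission
  imports Defs
begin

text \<open>
  The lower bounds hold for every \<open>\<mu>\<close>. A cover of a nonempty set contains at least one ball
  centred in \<open>K\<close>, so the covering moment at scale \<open>r\<close> is at least the extreme value of
  \<open>\<pi>(B(x,r))^q\<close> over \<open>x \<in> K\<close>. Once \<open>\<rho>\<close> exceeds the diameter of \<open>K\<close>, the ball \<open>B(y,\<rho>)\<close> contains
  \<open>K\<close>, and that extreme value is what the exponents \<open>upper_D_max\<close> and \<open>lower_D_min\<close> measure.

  The upper bounds are generic. Finitely supported measures are dense, and a set of \<open>N\<close> points
  is covered by \<open>N\<close> balls, where \<open>N\<close> is at most \<open>r^(-\<epsilon>)\<close> at all small scales. If \<open>t\<close> lies
  below \<open>upper_D_unif_max\<close> (or above \<open>lower_D_unif_min\<close>), then inside a certain ball \<open>B(z,\<kappa>)\<close>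
  every finite set of points can be moved slightly so that, at arbitrarily small scales \<open>r\<close>,
  all the balls \<open>B(x,r)\<close> around the moved points have mass less (or greater) than \<open>r^t\<close>; the
  property \<open>attains_scales\<close> records this. Hence the measures that give mass greater than
  \<open>1 - \<eta>\<close> to the union of few balls of this kind and of the complement of a smaller closed
  ball form an open dense set, for all \<open>\<epsilon>\<close> and \<open>\<eta>\<close>. A measure in all these sets that charges
  the smaller ball gives positive mass to a set \<open>E\<close> that has economical covers at arbitrarily
  small scales (\<open>sparsely_coverable_residual\<close>), and this bounds the box dimension of \<open>E\<close> by
  \<open>-q t\<close>. Only countably many \<open>t\<close> are needed, and \<open>E\<close> does not depend on \<open>q\<close>.

  It remains to know that countable intersections of such open sets are dense. Measures are
  represented as laws of random variables with values in \<open>K\<close> on one fixed probability space.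
  The law depends continuously on the variable in mean (\<open>distr_weak_open_stable\<close>), and random
  variables are complete in mean (\<open>mean_dist_complete\<close>); so if each open set can be reached by
  an arbitrarily small perturbation of any random variable, Baire's argument applies to the
  variables instead of the measures (\<open>coupling_dense_Inter_dense\<close>).
\<close>

section \<open>The weak topology\<close>

lemma prob_measuresD:
  assumes "\<mu> \<in> prob_measures K"
  shows "prob_space \<mu>" "sets \<mu> = sets (restrict_space borel K)" "space \<mu> = K"
  using assms sets_eq_imp_space_eq[of \<mu> "restrict_space borel K"]
  by (auto simp: space_prob_algebra space_restrict_space)

lemma prob_measures_imp_nonempty:
  assumes "\<mu> \<in> prob_measures K"
  shows "K \<noteq> {}"
  using prob_measuresD(1,3)[OF assms] prob_space.not_empty by metis

lemma topspace_weak_topology: "topspace (weak_topology K) = prob_measures K"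
proof -
  have "prob_measures K \<in> {{\<mu> \<in> prob_measures K. (\<integral>x. f x \<partial>\<mu>) \<in> U} | (f :: 'a \<Rightarrow> real) U.
        continuous_on K f \<and> open U}"
    by (rule CollectI, rule exI[of _ "\<lambda>_. 0"], rule exI[of _ UNIV]) auto
  then show ?thesis
    unfolding weak_topology_def topology_generated_by_topspace by blast
qed

lemma openin_weak_topology_integral:
  fixes f :: "'a::topological_space \<Rightarrow> real"
  assumes "continuous_on K f" "open U"
  shows "openin (weak_topology K) {\<mu> \<in> prob_measures K. (\<integral>x. f x \<partial>\<mu>) \<in> U}"
  unfolding weak_topology_def
  by (rule topology_generated_by_Basis) (use assms in blast)

lemma open_in_sets_restrict:
  assumes "open V" shows "K \<inter> V \<in> sets (restrict_space borel K)"
  using assms by (auto simp: sets_restrict_space)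

text \<open>
  The indicator of \<open>V\<close> is the limit of the smaller continuous functions \<open>min 1 (n d(x, - V))\<close>,
  so a lower bound for the mass of \<open>V\<close> is already witnessed by the integral of one of them,
  and this is an open condition.
\<close>

lemma openin_weak_topology_mass_gt:
  fixes K V :: "'a::metric_space set"
  assumes V: "open V"
  shows "openin (weak_topology K) {\<mu> \<in> prob_measures K. c < measure \<mu> (K \<inter> V)}"
proof (cases "V = UNIV")
  case True
  have "measure \<mu> K = 1" if "\<mu> \<in> prob_measures K" for \<mu>
    using prob_measuresD[OF that] prob_space.prob_space by metis
  then have "{\<mu> \<in> prob_measures K. c < measure \<mu> (K \<inter> V)} =
      (if c < 1 then topspace (weak_topology K) else {})"
    by (auto simp: True topspace_weak_topology)
  then show ?thesis by simp
next
  case False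
  define f where "f n x = min 1 (real n * infdist x (- V))" for n x
  have cont: "continuous_on K (f n)" for n
    unfolding f_def by (intro continuous_intros)
  have f_le: "f n x \<le> indicat_real V x" for n x
  proof (cases "x \<in> V")
    case False
    then show ?thesis by (simp add: f_def)
  qed (auto simp: f_def)
  have f_ge: "0 \<le> f n x" for n x
    by (auto simp: f_def infdist_nonneg)
  have f_le1: "f n x \<le> 1" for n x
    by (simp add: f_def)
  have lim: "(\<lambda>n. f n x) \<longlonglongrightarrow> indicat_real V x" for x
  proof (cases "x \<in> V")
    case True
    have d: "infdist x (- V) > 0"
      using V False True infdist_pos_not_in_closed[of "- V" x] by (auto simp: closed_def)
    then obtain N where N: "1 / infdist x (- V) < real N"
      using reals_Archimedean2 by blast
    have "f n x = 1" if "n \<ge> N" for n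
    proof -
      have "1 / infdist x (- V) < real n" using N that by linarith
      then have "1 \<le> real n * infdist x (- V)" using d by (simp add: field_simps)
      then show ?thesis by (simp add: f_def)
    qed
    then have "eventually (\<lambda>n. f n x = 1) sequentially"
      using eventually_sequentially by blast
    then show ?thesis using True by (simp add: tendsto_eventually)
  next
    case False
    then show ?thesis by (simp add: f_def)
  qed
  show ?thesis
  proof (subst openin_subopen, intro ballI)
    fix \<mu> assume "\<mu> \<in> {\<mu> \<in> prob_measures K. c < measure \<mu> (K \<inter> V)}"
    then have \<mu>: "\<mu> \<in> prob_measures K" and c: "c < measure \<mu> (K \<inter> V)" by auto
    have le: "(\<integral>x. f n x \<partial>\<nu>) \<le> measure \<nu> (K \<inter> V)"
      and lm: "(\<lambda>n. \<integral>x. f n x \<partial>\<nu>) \<longlonglongrightarrow> measure \<nu> (K \<inter> V)" if \<nu>: "\<nu> \<in> prob_measures K" for \<nu> n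
    proof -
      interpret prob_space \<nu> by (rule prob_measuresD[OF \<nu>])
      note S = prob_measuresD(2,3)[OF \<nu>]
      have KV: "K \<inter> V \<in> sets \<nu>" using open_in_sets_restrict[OF V] S by simp
      have meas_f[measurable]: "f n \<in> borel_measurable \<nu>" for n
        using borel_measurable_continuous_on_restrict[OF cont[of n]] S(1)
        by (simp cong: measurable_cong_sets)
      have eq: "(\<integral>x. indicat_real V x \<partial>\<nu>) = (\<integral>x. indicat_real (K \<inter> V) x \<partial>\<nu>)"
        by (rule Bochner_Integration.integral_cong) (auto simp: S indicator_def)
      then have 1: "(\<integral>x. indicat_real V x \<partial>\<nu>) = measure \<nu> (K \<inter> V)"
        using KV by simp
      have mV[measurable]: "indicat_real V \<in> borel_measurable \<nu>"
      proof -
        have "indicat_real V x = indicat_real (K \<inter> V) x" if "x \<in> space \<nu>" for x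
          using that by (simp add: S indicator_def)
        then show ?thesis
          using measurable_cong[of \<nu> "indicat_real V" "indicat_real (K \<inter> V)" borel]
            borel_measurable_indicator[OF KV, where 'b = real] by blast
      qed
      have "(\<lambda>n. \<integral>x. f n x \<partial>\<nu>) \<longlonglongrightarrow> (\<integral>x. indicat_real V x \<partial>\<nu>)"
        by (rule integral_dominated_convergence[where w = "\<lambda>_. 1"])
           (use lim f_ge f_le1 in auto)
      then show "(\<lambda>n. \<integral>x. f n x \<partial>\<nu>) \<longlonglongrightarrow> measure \<nu> (K \<inter> V)"
        using 1 by simp
      have "(\<integral>x. f n x \<partial>\<nu>) \<le> (\<integral>x. indicat_real V x \<partial>\<nu>)"
      proof (rule integral_mono)
        show "integrable \<nu> (f n)"
          by (rule integrable_const_bound[where B = 1]) (use f_ge f_le1 in auto)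
        show "integrable \<nu> (indicat_real V)"
          by (rule integrable_const_bound[where B = 1]) (auto simp: indicator_def)
      qed (rule f_le)
      then show "(\<integral>x. f n x \<partial>\<nu>) \<le> measure \<nu> (K \<inter> V)" using 1 by simp
    qed
    from order_tendstoD(1)[OF lm[OF \<mu>] c] obtain n where n: "c < (\<integral>x. f n x \<partial>\<mu>)"
      by (meson eventually_happens sequentially_bot)
    show "\<exists>T. openin (weak_topology K) T \<and> \<mu> \<in> T \<and>
        T \<subseteq> {\<mu> \<in> prob_measures K. c < measure \<mu> (K \<inter> V)}"
      by (rule exI[of _ "{\<nu> \<in> prob_measures K. (\<integral>x. f n x \<partial>\<nu>) \<in> {c<..}}"])
         (use openin_weak_topology_integral[OF cont, of "{c<..}" n] n \<mu> le[of _ n] in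
           \<open>auto intro: less_le_trans\<close>)
  qed
qed

lemma distr_in_prob_measures:
  assumes "prob_space M" "X \<in> M \<rightarrow>\<^sub>M restrict_space borel K"
  shows "distr M (restrict_space borel K) X \<in> prob_measures K"
  using assms by (simp add: space_prob_algebra prob_space.prob_space_distr)

lemma random_variable_in:
  assumes "X \<in> M \<rightarrow>\<^sub>M restrict_space borel K" "\<omega> \<in> space M"
  shows "X \<omega> \<in> K"
  using measurable_space[OF assms] by (simp add: space_restrict_space)

lemma random_variable_borel:
  assumes "X \<in> M \<rightarrow>\<^sub>M restrict_space borel K"
  shows "X \<in> borel_measurable M"
  using assms by (simp add: measurable_restrict_space2_iff)

text \<open>
  If \<open>\<bar>f\<bar> \<le> B\<close>, and points at distance below \<open>d\<close> have values within \<open>e\<close>, then for all other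
  pairs of points the oscillation \<open>2 B\<close> is at most \<open>2 B / d\<close> times their distance. This form of
  uniform continuity can be integrated, which turns closeness in mean into closeness of
  expectations.
\<close>

lemma continuous_on_compact_almost_lipschitz:
  fixes f :: "'a::metric_space \<Rightarrow> real"
  assumes K: "compact K" and f: "continuous_on K f" and e: "0 < e"
  obtains C where "C > 0" "\<And>x y. x \<in> K \<Longrightarrow> y \<in> K \<Longrightarrow> \<bar>f x - f y\<bar> \<le> e + C * dist x y"
proof -
  obtain B where B: "B > 0" "\<And>x. x \<in> K \<Longrightarrow> \<bar>f x\<bar> \<le> B"
    using compact_imp_bounded[OF compact_continuous_image[OF f K]]
    by (force simp: bounded_pos)
  obtain d where d: "d > 0" "\<And>x y. x \<in> K \<Longrightarrow> y \<in> K \<Longrightarrow> dist x y < d \<Longrightarrow> \<bar>f x - f y\<bar> < e"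
    using compact_uniformly_continuous[OF f K] e
    unfolding uniformly_continuous_on_def dist_real_def by (metis dist_commute)
  have "\<bar>f x - f y\<bar> \<le> e + (2 * B / d) * dist x y" if "x \<in> K" "y \<in> K" for x y
  proof (cases "dist x y < d")
    case True
    have "0 \<le> (2 * B / d) * dist x y" using B d by simp
    then show ?thesis using d(2)[OF that True] by linarith
  next
    case False
    have "\<bar>f x - f y\<bar> \<le> 2 * B" using B(2)[OF that(1)] B(2)[OF that(2)] by linarith
    also have "2 * B \<le> (2 * B / d) * dist x y"
      using False B d by (simp add: field_simps)
    finally show ?thesis using e by linarith
  qed
  then show ?thesis using that[of "2 * B / d"] B d by simp
qed

definition mean_dist :: "'b measure \<Rightarrow> ('b \<Rightarrow> 'a::metric_space) \<Rightarrow> ('b \<Rightarrow> 'a) \<Rightarrow> ennreal" where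
  "mean_dist M X Y = (\<integral>\<^sup>+\<omega>. ennreal (dist (X \<omega>) (Y \<omega>)) \<partial>M)"

lemma distr_weak_open_stable:
  fixes K :: "'a::{metric_space, second_countable_topology} set"
  assumes K: "compact K" and M: "prob_space M" and X: "X \<in> M \<rightarrow>\<^sub>M restrict_space borel K"
    and U: "openin (weak_topology K) U" and XU: "distr M (restrict_space borel K) X \<in> U"
  shows "\<exists>\<delta>>0. \<forall>Y \<in> M \<rightarrow>\<^sub>M restrict_space borel K.
    mean_dist M X Y < ennreal \<delta> \<longrightarrow> distr M (restrict_space borel K) Y \<in> U"
proof -
  let ?R = "restrict_space borel K"
  let ?S = "\<lambda>\<delta> U. \<forall>Y \<in> M \<rightarrow>\<^sub>M ?R. mean_dist M X Y < ennreal \<delta> \<longrightarrow> distr M ?R Y \<in> U"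
  interpret prob_space M by fact
  have "generate_topology_on {{\<mu> \<in> prob_measures K. (\<integral>x. f x \<partial>\<mu>) \<in> U} | (f :: 'a \<Rightarrow> real) U.
        continuous_on K f \<and> open U} U"
    using U unfolding weak_topology_def openin_topology_generated_by_iff .
  \<comment> \<open>It suffices to treat the subbasic sets, where the almost Lipschitz bound applies.\<close>
  then show ?thesis using XU
  proof induction
    case (Int a b)
    then obtain d1 d2 where d: "d1 > 0" "?S d1 a" "d2 > 0" "?S d2 b" by blast
    have "?S (min d1 d2) (a \<inter> b)"
    proof (intro ballI impI IntI)
      fix Y assume Y: "Y \<in> M \<rightarrow>\<^sub>M ?R" "mean_dist M X Y < ennreal (min d1 d2)"
      have "ennreal (min d1 d2) \<le> ennreal d1" "ennreal (min d1 d2) \<le> ennreal d2"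
        by (auto intro: ennreal_leI)
      then show "distr M ?R Y \<in> a" "distr M ?R Y \<in> b" using Y d by (meson less_le_trans)+
    qed
    then show ?case using d by (intro exI[of _ "min d1 d2"]) auto
  next
    case (UN A)
    then obtain a where a: "a \<in> A" "distr M ?R X \<in> a" by blast
    then show ?case using UN.IH[OF a] by (meson UnionI)
  next
    case (Basis s)
    then obtain f :: "'a \<Rightarrow> real" and V where s: "s = {\<mu> \<in> prob_measures K. (\<integral>x. f x \<partial>\<mu>) \<in> V}"
      and f: "continuous_on K f" and V: "open V" by blast
    have fm: "f \<in> borel_measurable ?R" by (rule borel_measurable_continuous_on_restrict[OF f])
    have law: "(\<integral>x. f x \<partial>distr M ?R Y) = (\<integral>\<omega>. f (Y \<omega>) \<partial>M)" if "Y \<in> M \<rightarrow>\<^sub>M ?R" for Y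
      by (rule integral_distr[OF that fm])
    have "(\<integral>\<omega>. f (X \<omega>) \<partial>M) \<in> V" using Basis s law[OF X] by simp
    then obtain e where e: "e > 0" "\<And>t. \<bar>t - (\<integral>\<omega>. f (X \<omega>) \<partial>M)\<bar> < e \<Longrightarrow> t \<in> V"
      using V unfolding open_dist dist_real_def by blast
    obtain C where C: "C > 0" "\<And>x y. x \<in> K \<Longrightarrow> y \<in> K \<Longrightarrow> \<bar>f x - f y\<bar> \<le> e / 2 + C * dist x y"
      using continuous_on_compact_almost_lipschitz[OF K f, of "e / 2"] e by auto
    obtain B where B: "\<And>x. x \<in> K \<Longrightarrow> \<bar>f x\<bar> \<le> B"
      using compact_imp_bounded[OF compact_continuous_image[OF f K]]
      by (force simp: bounded_pos)
    have int: "integrable M (\<lambda>\<omega>. f (Y \<omega>))" if Y: "Y \<in> M \<rightarrow>\<^sub>M ?R" for Y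
    proof (rule integrable_const_bound[where B = B])
      show "(\<lambda>\<omega>. f (Y \<omega>)) \<in> borel_measurable M" using measurable_compose[OF Y fm] .
      show "AE \<omega> in M. norm (f (Y \<omega>)) \<le> B" using B random_variable_in[OF Y] by auto
    qed
    have "?S (e / (2 * C)) s"
    proof (intro ballI impI)
      fix Y assume Y: "Y \<in> M \<rightarrow>\<^sub>M ?R" and d: "mean_dist M X Y < ennreal (e / (2 * C))"
      have m: "(\<lambda>\<omega>. dist (X \<omega>) (Y \<omega>)) \<in> borel_measurable M"
        using random_variable_borel[OF X] random_variable_borel[OF Y] by measurable
      have di: "integrable M (\<lambda>\<omega>. dist (X \<omega>) (Y \<omega>))"
        using m d unfolding mean_dist_def
        by (intro integrableI_nonneg) (auto simp: order.strict_trans)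
      have dE: "(\<integral>\<omega>. dist (X \<omega>) (Y \<omega>) \<partial>M) < e / (2 * C)"
        using d nn_integral_eq_integral[OF di] C(1) e unfolding mean_dist_def
        by (simp add: ennreal_less_iff)
      have "\<bar>(\<integral>\<omega>. f (X \<omega>) \<partial>M) - (\<integral>\<omega>. f (Y \<omega>) \<partial>M)\<bar> = \<bar>\<integral>\<omega>. f (X \<omega>) - f (Y \<omega>) \<partial>M\<bar>"
        using int[OF X] int[OF Y] by simp
      also have "\<dots> \<le> (\<integral>\<omega>. \<bar>f (X \<omega>) - f (Y \<omega>)\<bar> \<partial>M)"
        by (rule integral_abs_bound)
      also have "\<dots> \<le> (\<integral>\<omega>. e / 2 + C * dist (X \<omega>) (Y \<omega>) \<partial>M)"
        by (rule integral_mono)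
           (use int[OF X] int[OF Y] di C random_variable_in[OF X] random_variable_in[OF Y] in auto)
      also have "\<dots> = e / 2 + C * (\<integral>\<omega>. dist (X \<omega>) (Y \<omega>) \<partial>M)"
        using di prob_space by simp
      also have "\<dots> < e / 2 + C * (e / (2 * C))"
        using dE C(1) by (intro add_strict_left_mono mult_strict_left_mono)
      also have "\<dots> = e" using C(1) by simp
      finally have "(\<integral>\<omega>. f (Y \<omega>) \<partial>M) \<in> V" using e(2) by (simp add: abs_minus_commute)
      then show "distr M ?R Y \<in> s"
        using law[OF Y] distr_in_prob_measures[OF M Y] by (simp add: s)
    qed
    then show ?case using e C by (intro exI[of _ "e / (2 * C)"]) auto
  qed simp
qed

section \<open>Random variables and the Baire property\<close>

text \<open>
  A law is given positive mass in a prescribed place by changing the random variable on an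
  event of small positive probability; this property provides such events.
\<close>

definition has_small_events :: "'b measure \<Rightarrow> bool" where
  "has_small_events M \<longleftrightarrow> (\<forall>\<epsilon>>0. \<exists>A\<in>sets M. 0 < emeasure M A \<and> emeasure M A < ennreal \<epsilon>)"

text \<open>
  A strengthening of density in which the approximation takes place on the given probability
  space, so that it can be iterated and passed to a limit. The sample space \<open>'a \<times> real\<close> has
  room for any prescribed law together with an independent uniform variable.
\<close>

definition coupling_dense :: "'a::metric_space set \<Rightarrow> 'a measure set \<Rightarrow> bool" where
  "coupling_dense K U \<longleftrightarrow> (\<forall>(M :: ('a \<times> real) measure) X \<epsilon>.
     prob_space M \<longrightarrow> has_small_events M \<longrightarrow> X \<in> M \<rightarrow>\<^sub>M restrict_space borel K \<longrightarrow> \<epsilon> > 0 \<longrightarrow>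
     (\<exists>Y \<in> M \<rightarrow>\<^sub>M restrict_space borel K.
        mean_dist M X Y < ennreal \<epsilon> \<and> distr M (restrict_space borel K) Y \<in> U))"

lemma coupling_denseE:
  fixes K :: "'a::metric_space set" and M :: "('a \<times> real) measure"
  assumes "coupling_dense K U" "prob_space M" "has_small_events M"
    "X \<in> M \<rightarrow>\<^sub>M restrict_space borel K" "\<epsilon> > 0"
  obtains Y where "Y \<in> M \<rightarrow>\<^sub>M restrict_space borel K" "mean_dist M X Y < ennreal \<epsilon>"
    "distr M (restrict_space borel K) Y \<in> U"
  using assms unfolding coupling_dense_def by blast

lemma prob_measure_as_law:
  fixes \<mu> :: "'a::metric_space measure"
  assumes "\<mu> \<in> prob_measures K"
  obtains M :: "('a \<times> real) measure" and X where "prob_space M" "has_small_events M"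
    "X \<in> M \<rightarrow>\<^sub>M restrict_space borel K" "distr M (restrict_space borel K) X = \<mu>"
proof -
  let ?L = "uniform_measure lborel {0..1::real}"
  let ?M = "\<mu> \<Otimes>\<^sub>M ?L"
  interpret \<mu>: prob_space \<mu> by (rule prob_measuresD[OF assms])
  interpret L: prob_space ?L by (rule prob_space_uniform_measure) auto
  interpret P: pair_prob_space \<mu> ?L ..
  have small: "has_small_events ?M"
    unfolding has_small_events_def
  proof (intro allI impI)
    fix \<epsilon> :: real assume "\<epsilon> > 0"
    let ?d = "min 1 (\<epsilon> / 2)"
    have "emeasure ?M (space \<mu> \<times> {0..?d}) = emeasure \<mu> (space \<mu>) * emeasure ?L {0..?d}"
      by (rule L.emeasure_pair_measure_Times) auto
    also have "emeasure ?L {0..?d} = ennreal ?d"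
      using \<open>\<epsilon> > 0\<close> by (subst emeasure_uniform_measure) (auto simp: min_def divide_ennreal_def)
    finally have "emeasure ?M (space \<mu> \<times> {0..?d}) = ennreal ?d"
      by (simp add: \<mu>.emeasure_space_1)
    moreover have "0 < ennreal ?d" "ennreal ?d < ennreal \<epsilon>"
      using \<open>\<epsilon> > 0\<close> by (auto simp: ennreal_less_iff)
    moreover have "space \<mu> \<times> {0..?d} \<in> sets ?M" by auto
    ultimately show "\<exists>A\<in>sets ?M. 0 < emeasure ?M A \<and> emeasure ?M A < ennreal \<epsilon>" by metis
  qed
  have fst: "fst \<in> ?M \<rightarrow>\<^sub>M restrict_space borel K"
    using prob_measuresD(2)[OF assms] by (simp cong: measurable_cong_sets)
  have "distr ?M (restrict_space borel K) fst = distr ?M \<mu> fst"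
    using prob_measuresD(2)[OF assms] by (intro distr_cong) auto
  also have "\<dots> = \<mu>" by (rule L.distr_pair_fst)
  finally show ?thesis by (rule that[OF P.prob_space_axioms small fst])
qed

text \<open>
  Completeness in mean: consecutive distances are summable, so almost surely the trajectory
  is Cauchy in the complete set \<open>K\<close>. On the exceptional null set the limit is given an
  arbitrary value in \<open>K\<close>.
\<close>

lemma mean_dist_complete:
  fixes K :: "'a::euclidean_space set" and X :: "nat \<Rightarrow> 'b \<Rightarrow> 'a"
  assumes K: "compact K" "K \<noteq> {}"
    and X: "\<And>n. X n \<in> M \<rightarrow>\<^sub>M restrict_space borel K"
    and fin: "(\<Sum>n. mean_dist M (X n) (X (Suc n))) < \<infinity>"
  obtains Z where "Z \<in> M \<rightarrow>\<^sub>M restrict_space borel K"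
    "\<And>n. mean_dist M (X n) Z \<le> (\<Sum>k. mean_dist M (X (n + k)) (X (Suc (n + k))))"
proof -
  obtain x0 where x0: "x0 \<in> K" using K by blast
  have Xb[measurable]: "X n \<in> borel_measurable M" for n by (rule random_variable_borel[OF X])
  define Z where "Z \<omega> = (if Cauchy (\<lambda>n. X n \<omega>) then lim (\<lambda>n. X n \<omega>) else x0)" for \<omega>
  have Zm: "Z \<in> borel_measurable M" unfolding Z_def by measurable
  have ZK: "Z \<omega> \<in> K" if "\<omega> \<in> space M" for \<omega>
  proof (cases "Cauchy (\<lambda>n. X n \<omega>)")
    case True
    then have "(\<lambda>n. X n \<omega>) \<longlonglongrightarrow> lim (\<lambda>n. X n \<omega>)"
      by (simp add: Cauchy_convergent_iff convergent_LIMSEQ_iff)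
    then have "lim (\<lambda>n. X n \<omega>) \<in> K"
      by (rule closed_sequentially[OF compact_imp_closed[OF K(1)] random_variable_in[OF X that]])
    then show ?thesis using True by (simp add: Z_def)
  qed (simp add: Z_def x0)
  have Z: "Z \<in> M \<rightarrow>\<^sub>M restrict_space borel K"
    using Zm ZK by (simp add: measurable_restrict_space2_iff)
  let ?D = "\<lambda>n k \<omega>. ennreal (dist (X (n + k) \<omega>) (X (Suc (n + k)) \<omega>))"
  have sum: "(\<integral>\<^sup>+\<omega>. (\<Sum>k. ?D n k \<omega>) \<partial>M) = (\<Sum>k. mean_dist M (X (n + k)) (X (Suc (n + k))))" for n
    unfolding mean_dist_def by (rule nn_integral_suminf) measurable
  have "AE \<omega> in M. (\<Sum>k. ?D 0 k \<omega>) \<noteq> \<infinity>"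
    by (rule nn_integral_PInf_AE) (use fin sum[of 0] in auto)
  then have dist_le: "AE \<omega> in M. dist (X n \<omega>) (Z \<omega>) \<le> (\<Sum>k. ?D n k \<omega>)" for n
  proof eventually_elim
    case (elim \<omega>)
    then have s: "summable (\<lambda>k. dist (X k \<omega>) (X (Suc k) \<omega>))"
      by (intro summable_suminf_not_top) auto
    have d: "dist (X n \<omega>) (X (n + m) \<omega>) \<le> (\<Sum>k<m. dist (X (n + k) \<omega>) (X (Suc (n + k)) \<omega>))" for n m
    proof (induction m)
      case (Suc m)
      have "dist (X n \<omega>) (X (n + Suc m) \<omega>) \<le>
          dist (X n \<omega>) (X (n + m) \<omega>) + dist (X (n + m) \<omega>) (X (Suc (n + m)) \<omega>)"
        using dist_triangle by simp
      then show ?case using Suc by simp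
    qed simp
    have sn: "summable (\<lambda>k. dist (X (n + k) \<omega>) (X (Suc (n + k)) \<omega>))" for n
      using summable_ignore_initial_segment[OF s, of n] by (simp add: add.commute)
    have d2: "dist (X n \<omega>) (X (n + m) \<omega>) \<le> (\<Sum>k. dist (X (n + k) \<omega>) (X (Suc (n + k)) \<omega>))" for n m
      using d[of n m] sum_le_suminf[OF sn[of n], of "{..<m}"] by (meson finite_lessThan order_trans zero_le_dist)
    have tail: "(\<lambda>n. \<Sum>k. dist (X (n + k) \<omega>) (X (Suc (n + k)) \<omega>)) \<longlonglongrightarrow> 0"
      using suminf_exist_split2[OF s] by (simp add: add.commute)
    have C: "Cauchy (\<lambda>n. X n \<omega>)"
    proof (rule CauchyI')
      fix e :: real assume "e > 0"
      from order_tendstoD(2)[OF tail this]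
      obtain N where N: "\<And>n. n \<ge> N \<Longrightarrow> (\<Sum>k. dist (X (n + k) \<omega>) (X (Suc (n + k)) \<omega>)) < e"
        unfolding eventually_sequentially by blast
      show "\<exists>M. \<forall>m\<ge>M. \<forall>n>m. dist (X m \<omega>) (X n \<omega>) < e"
      proof (intro exI allI impI)
        fix m n assume "m \<ge> N" "m < n"
        then show "dist (X m \<omega>) (X n \<omega>) < e" using d2[of m "n - m"] N[of m] by simp
      qed
    qed
    then have "(\<lambda>m. X m \<omega>) \<longlonglongrightarrow> Z \<omega>"
      by (simp add: Z_def Cauchy_convergent_iff convergent_LIMSEQ_iff)
    then have "(\<lambda>m. dist (X n \<omega>) (X (n + m) \<omega>)) \<longlonglongrightarrow> dist (X n \<omega>) (Z \<omega>)"
      using LIMSEQ_ignore_initial_segment[of "\<lambda>m. X m \<omega>" "Z \<omega>" n]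
      by (intro tendsto_dist tendsto_const) (simp add: add.commute)
    then have "dist (X n \<omega>) (Z \<omega>) \<le> (\<Sum>k. dist (X (n + k) \<omega>) (X (Suc (n + k)) \<omega>))"
      by (rule LIMSEQ_le_const2) (use d2 in blast)
    then have "ennreal (dist (X n \<omega>) (Z \<omega>)) \<le>
        ennreal (\<Sum>k. dist (X (n + k) \<omega>) (X (Suc (n + k)) \<omega>))"
      by (rule ennreal_leI)
    also have "\<dots> = (\<Sum>k. ?D n k \<omega>)"
      by (rule suminf_ennreal2[symmetric]) (use sn in auto)
    finally show ?case .
  qed
  have "mean_dist M (X n) Z \<le> (\<Sum>k. mean_dist M (X (n + k)) (X (Suc (n + k))))" for n
    unfolding sum[symmetric] unfolding mean_dist_def by (rule nn_integral_mono_AE[OF dist_le])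
  then show ?thesis using that[OF Z] by blast
qed

lemma suminf_geometric_le:
  assumes a: "\<And>k. a k \<le> ennreal (c * (1 / 2) ^ k)" and c: "0 \<le> c"
  shows "(\<Sum>k. a k) \<le> ennreal (2 * c)"
proof -
  have "(\<Sum>k. a k) \<le> (\<Sum>k. ennreal (c * (1 / 2) ^ k))"
    by (rule suminf_le) (use a in auto)
  also have "\<dots> = ennreal (\<Sum>k. c * (1 / 2) ^ k)"
    using c by (intro suminf_ennreal2) (auto intro!: summable_mult summable_geometric)
  also have "(\<Sum>k. c * (1 / 2) ^ k) = 2 * c"
    by (subst suminf_mult) (auto simp: suminf_geometric summable_geometric)
  finally show ?thesis .
qed

text \<open>
  Baire's argument along random variables: starting from a variable with law in a given open
  set \<open>W\<close>, each step reaches one more \<open>U n\<close> by a perturbation that is small compared with the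
  margins by which the earlier open sets contain the current law.
\<close>

lemma coupling_dense_Inter_dense:
  fixes K :: "'a::euclidean_space set" and U :: "nat \<Rightarrow> 'a measure set"
  assumes K: "compact K"
    and op: "\<And>n. openin (weak_topology K) (U n)" and cd: "\<And>n. coupling_dense K (U n)"
  shows "weak_topology K closure_of (prob_measures K \<inter> (\<Inter>n. U n)) = prob_measures K"
proof -
  let ?R = "restrict_space borel K"
  have "(prob_measures K \<inter> (\<Inter>n. U n)) \<inter> W \<noteq> {}"
    if W: "openin (weak_topology K) W" "W \<noteq> {}" for W
  proof -
    obtain \<mu> where \<mu>: "\<mu> \<in> W" "\<mu> \<in> prob_measures K"
      using W openin_subset topspace_weak_topology by fastforce
    then have "K \<noteq> {}" by (simp add: prob_measures_imp_nonempty)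
    obtain M :: "('a \<times> real) measure" and X0 where M: "prob_space M" "has_small_events M"
      and X0: "X0 \<in> M \<rightarrow>\<^sub>M ?R" "distr M ?R X0 = \<mu>"
      using prob_measure_as_law[OF \<mu>(2)] by blast
    \<comment> \<open>Position \<open>0\<close> is taken by \<open>W\<close>, which is treated like the sets \<open>U n\<close>.\<close>
    define V where "V n = (case n of 0 \<Rightarrow> W | Suc k \<Rightarrow> U k)" for n
    have opV: "openin (weak_topology K) (V n)" for n
      using W op by (auto simp: V_def split: nat.split)
    define stable where "stable n X \<delta> \<longleftrightarrow> X \<in> M \<rightarrow>\<^sub>M ?R \<and> \<delta> > (0::real) \<and> (\<forall>Y \<in> M \<rightarrow>\<^sub>M ?R.
        mean_dist M X Y < ennreal \<delta> \<longrightarrow> distr M ?R Y \<in> V n)" for n X \<delta>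
    have shrink: "\<exists>\<delta>\<le>d. stable n X \<delta>" if X: "X \<in> M \<rightarrow>\<^sub>M ?R" "distr M ?R X \<in> V n" "d > 0" for X n d
    proof -
      obtain \<delta> where \<delta>: "\<delta> > 0"
        "\<forall>Y \<in> M \<rightarrow>\<^sub>M ?R. mean_dist M X Y < ennreal \<delta> \<longrightarrow> distr M ?R Y \<in> V n"
        using distr_weak_open_stable[OF K M(1) X(1) opV X(2)] by blast
      have "ennreal (min \<delta> d) \<le> ennreal \<delta>" by (rule ennreal_leI) simp
      then have "mean_dist M X Y < ennreal \<delta>" if "mean_dist M X Y < ennreal (min \<delta> d)" for Y
        using that less_le_trans by blast
      then have "stable n X (min \<delta> d)"
        using X \<delta> unfolding stable_def by simp
      then show ?thesis by (intro exI[of _ "min \<delta> d"]) auto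
    qed
    \<comment> \<open>With the factor \<open>1 / 4\<close> and halved margins, all later steps together move \<open>X n\<close> by at
      most \<open>\<delta> n / 2\<close>, so the limit keeps the law in \<open>V n\<close>.\<close>
    define step where "step p p' \<longleftrightarrow> mean_dist M (fst p) (fst p') < ennreal (snd p / 4) \<and>
        snd p' \<le> snd p / 2" for p p' :: "('a \<times> real \<Rightarrow> 'a) \<times> real"
    obtain s where s: "\<And>n. stable n (fst (s n)) (snd (s n))" "\<And>n. step (s n) (s (Suc n))"
    proof (rule exE[OF dependent_nat_choice])
      show "\<exists>p. stable 0 (fst p) (snd p)"
        using shrink[of X0 0 1] X0 \<mu> by (auto simp: V_def)
      show "\<exists>p'. stable (Suc n) (fst p') (snd p') \<and> step p p'" if p: "stable n (fst p) (snd p)" for p n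
      proof -
        have p': "fst p \<in> M \<rightarrow>\<^sub>M ?R" "snd p > 0" using p by (auto simp: stable_def)
        then obtain Y where Y: "Y \<in> M \<rightarrow>\<^sub>M ?R" "mean_dist M (fst p) Y < ennreal (snd p / 4)"
          "distr M ?R Y \<in> V (Suc n)"
          using coupling_denseE[OF cd[of n] M p'(1), of "snd p / 4"] by (auto simp: V_def)
        then obtain \<delta> where "\<delta> \<le> snd p / 2" "stable (Suc n) Y \<delta>"
          using shrink[of Y "Suc n" "snd p / 2"] p' by auto
        then show ?thesis using Y by (intro exI[of _ "(Y, \<delta>)"]) (auto simp: step_def)
      qed
    qed blast
    define X where "X n = fst (s n)" for n
    define \<delta> where "\<delta> n = snd (s n)" for n
    have X: "X n \<in> M \<rightarrow>\<^sub>M ?R" and \<delta>0: "\<delta> n > 0"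
      and st: "\<And>Y. Y \<in> M \<rightarrow>\<^sub>M ?R \<Longrightarrow> mean_dist M (X n) Y < ennreal (\<delta> n) \<Longrightarrow> distr M ?R Y \<in> V n"
      and X_step: "mean_dist M (X n) (X (Suc n)) < ennreal (\<delta> n / 4)" and \<delta>_step: "\<delta> (Suc n) \<le> \<delta> n / 2" for n
      using s[of n] unfolding stable_def step_def X_def \<delta>_def by auto
    have \<delta>_le: "\<delta> (n + k) \<le> \<delta> n * (1 / 2) ^ k" for n k
    proof (induction k)
      case (Suc k)
      then show ?case using \<delta>_step[of "n + k"] by simp
    qed simp
    have tail: "(\<Sum>k. mean_dist M (X (n + k)) (X (Suc (n + k)))) \<le> ennreal (2 * (\<delta> n / 4))" for n
    proof (rule suminf_geometric_le)
      fix k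
      have "mean_dist M (X (n + k)) (X (Suc (n + k))) \<le> ennreal (\<delta> (n + k) / 4)"
        using X_step by (simp add: order_less_imp_le)
      also have "\<dots> \<le> ennreal (\<delta> n / 4 * (1 / 2) ^ k)"
        by (rule ennreal_leI) (use \<delta>_le[of n k] in simp)
      finally show "mean_dist M (X (n + k)) (X (Suc (n + k))) \<le> ennreal (\<delta> n / 4 * (1 / 2) ^ k)" .
    qed (use \<delta>0[of n] in simp)
    have "(\<Sum>n. mean_dist M (X n) (X (Suc n))) < \<infinity>"
      using tail[of 0] by (auto intro: le_less_trans)
    from mean_dist_complete[OF K \<open>K \<noteq> {}\<close> X this] obtain Z where Z: "Z \<in> M \<rightarrow>\<^sub>M ?R"
      and XZ: "\<And>n. mean_dist M (X n) Z \<le> (\<Sum>k. mean_dist M (X (n + k)) (X (Suc (n + k))))" by blast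
    have ZV: "distr M ?R Z \<in> V n" for n
    proof (rule st[OF Z])
      have "mean_dist M (X n) Z \<le> ennreal (2 * (\<delta> n / 4))" using XZ tail order_trans by blast
      also have "\<dots> < ennreal (\<delta> n)" using \<delta>0[of n] by (simp add: ennreal_less_iff)
      finally show "mean_dist M (X n) Z < ennreal (\<delta> n)" .
    qed
    have "distr M ?R Z \<in> W" using ZV[of 0] by (simp add: V_def)
    moreover have "distr M ?R Z \<in> U n" for n using ZV[of "Suc n"] by (simp add: V_def)
    ultimately show ?thesis using distr_in_prob_measures[OF M(1) Z] by blast
  qed
  then show ?thesis
    using dense_intersects_open[of "weak_topology K"] topspace_weak_topology by metis
qed

text \<open>
  The form of genericity that the perturbation arguments produce; closed under countable
  conjunctions, and sufficient for a property to be typical.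
\<close>

definition coupling_residual :: "'a::metric_space set \<Rightarrow> ('a measure \<Rightarrow> bool) \<Rightarrow> bool" where
  "coupling_residual K Q \<longleftrightarrow> (\<exists>\<U>. countable \<U> \<and>
     (\<forall>U\<in>\<U>. openin (weak_topology K) U \<and> coupling_dense K U) \<and>
     (\<forall>\<mu>\<in>prob_measures K \<inter> \<Inter>\<U>. Q \<mu>))"

lemma coupling_residual_mono:
  assumes "coupling_residual K Q" "\<And>\<mu>. Q \<mu> \<Longrightarrow> R \<mu>"
  shows "coupling_residual K R"
  using assms unfolding coupling_residual_def by fast

lemma coupling_residual_countable_Ball:
  assumes "countable I" "\<And>i. i \<in> I \<Longrightarrow> coupling_residual K (Q i)"
  shows "coupling_residual K (\<lambda>\<mu>. \<forall>i\<in>I. Q i \<mu>)"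
proof -
  obtain \<U> where "\<And>i. i \<in> I \<Longrightarrow> countable (\<U> i) \<and>
     (\<forall>U\<in>\<U> i. openin (weak_topology K) U \<and> coupling_dense K U) \<and>
     (\<forall>\<mu>\<in>prob_measures K \<inter> \<Inter>(\<U> i). Q i \<mu>)"
    using assms(2) unfolding coupling_residual_def by metis
  then show ?thesis
    unfolding coupling_residual_def using assms(1)
    by (intro exI[of _ "\<Union>i\<in>I. \<U> i"]) auto
qed

lemma coupling_residual_conj:
  assumes "coupling_residual K Q" "coupling_residual K R"
  shows "coupling_residual K (\<lambda>\<mu>. Q \<mu> \<and> R \<mu>)"
proof -
  have "coupling_residual K (\<lambda>\<mu>. \<forall>b\<in>UNIV. (case b of True \<Rightarrow> Q | False \<Rightarrow> R) \<mu>)"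
    by (rule coupling_residual_countable_Ball) (use assms in \<open>auto split: bool.split\<close>)
  then show ?thesis by (simp add: all_bool_eq conj_commute)
qed

lemma coupling_residual_imp_typically:
  fixes K :: "'a::euclidean_space set"
  assumes K: "compact K" and Q: "coupling_residual K Q"
  shows "typically (weak_topology K) Q"
proof -
  obtain \<U> where \<U>: "countable \<U>" "\<And>U. U \<in> \<U> \<Longrightarrow> openin (weak_topology K) U \<and> coupling_dense K U"
    "\<And>\<mu>. \<mu> \<in> prob_measures K \<inter> \<Inter>\<U> \<Longrightarrow> Q \<mu>"
    using Q unfolding coupling_residual_def by blast
  let ?G = "prob_measures K \<inter> \<Inter>\<U>"
  have "gdelta_in (weak_topology K) (\<Inter>(insert (prob_measures K) \<U>))"
    by (rule gdelta_in_Inter)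
       (use \<U> openin_topspace[of "weak_topology K"] in
         \<open>auto simp: topspace_weak_topology intro!: open_imp_gdelta_in\<close>)
  moreover have "weak_topology K closure_of ?G = prob_measures K"
  proof (cases "\<U> = {}")
    case True
    then show ?thesis using closure_of_topspace[of "weak_topology K"] by (simp add: topspace_weak_topology)
  next
    case False
    then show ?thesis
      using coupling_dense_Inter_dense[OF K, of "from_nat_into \<U>"] \<U>
      by (simp add: from_nat_into range_from_nat_into)
  qed
  ultimately show ?thesis
    unfolding typically_def using \<U>(3) by (intro exI[of _ ?G]) (auto simp: topspace_weak_topology)
qed

section \<open>Generic measures charge sets with few good balls\<close>

text \<open>
  Here \<open>P x r\<close> says that the ball \<open>B(x,r)\<close> is good; the mass of good balls is controlled by a
  power of \<open>r\<close> in the application. A single parameter \<open>\<epsilon>\<close> bounds both the scale and the growth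
  exponent of the number of balls.
\<close>

definition sparse_cover ::
  "'a::metric_space set \<Rightarrow> ('a \<Rightarrow> real \<Rightarrow> bool) \<Rightarrow> real \<Rightarrow> 'a set \<Rightarrow> real \<Rightarrow> bool" where
  "sparse_cover K P \<epsilon> X r \<longleftrightarrow> 0 < r \<and> r < \<epsilon> \<and> finite X \<and> X \<subseteq> K \<and>
     real (card X) \<le> r powr (- \<epsilon>) \<and> (\<forall>x\<in>X. P x r)"

definition sparsely_coverable ::
  "'a::metric_space set \<Rightarrow> ('a \<Rightarrow> real \<Rightarrow> bool) \<Rightarrow> 'a set \<Rightarrow> bool" where
  "sparsely_coverable K P E \<longleftrightarrow>
     (\<forall>\<epsilon>>0. \<exists>X r. sparse_cover K P \<epsilon> X r \<and> E \<subseteq> (\<Union>x\<in>X. ball x r))"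

text \<open>
  The common content of the two uniform exponents: finitely many points can be moved
  simultaneously, at the same scale \<open>r\<close>, to centres of good balls.
\<close>

definition attains_scales ::
  "'a::metric_space set \<Rightarrow> ('a \<Rightarrow> real \<Rightarrow> bool) \<Rightarrow> 'a \<Rightarrow> real \<Rightarrow> bool" where
  "attains_scales K P z \<kappa> \<longleftrightarrow> (\<forall>F \<rho>. finite F \<longrightarrow> F \<noteq> {} \<longrightarrow> F \<subseteq> K \<inter> ball z \<kappa> \<longrightarrow> 0 < \<rho> \<longrightarrow>
     (\<exists>\<^sub>F r in at_right 0. \<forall>y\<in>F. \<exists>x\<in>K \<inter> ball y \<rho>. P x r))"

lemma eventually_le_powr_neg:
  fixes c \<epsilon> :: real
  assumes "\<epsilon> > 0"
  shows "\<forall>\<^sub>F r in at_right 0. c \<le> r powr (- \<epsilon>)"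
proof -
  define d where "d = max c 1"
  have d: "d > 0" "c \<le> d" by (auto simp: d_def)
  have "\<forall>\<^sub>F r in at_right 0. r \<in> {0<..<d powr (- 1 / \<epsilon>)}"
    using d by (intro eventually_at_right_real) simp
  then show ?thesis
  proof eventually_elim
    case (elim r)
    have "(d powr (- 1 / \<epsilon>)) powr (- \<epsilon>) \<le> r powr (- \<epsilon>)"
      using elim assms by (intro powr_mono2') auto
    then show ?case using assms d by (simp add: powr_powr)
  qed
qed

text \<open>
  Sending a small event to the centre \<open>z\<close> charges the ball, and costs in mean at most the
  diameter of \<open>K\<close> times the probability of the event.
\<close>

lemma coupling_dense_ball_pos:
  fixes K :: "'a::euclidean_space set"
  assumes K: "compact K" and z: "z \<in> K" and \<kappa>: "\<kappa> > 0"
  shows "coupling_dense K {\<mu> \<in> prob_measures K. 0 < measure \<mu> (K \<inter> ball z \<kappa>)}"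
  unfolding coupling_dense_def
proof (intro allI impI)
  fix M :: "('a \<times> real) measure" and X and \<epsilon> :: real
  let ?R = "restrict_space borel K"
  assume M: "prob_space M" "has_small_events M" and X: "X \<in> M \<rightarrow>\<^sub>M ?R" and \<epsilon>: "\<epsilon> > 0"
  interpret prob_space M by fact
  obtain B0 where B0: "\<forall>x\<in>K. dist z x \<le> B0"
    using compact_imp_bounded[OF K] bounded_any_center by blast
  define B where "B = max B0 1"
  have B: "B > 0" "\<And>x. x \<in> K \<Longrightarrow> dist x z \<le> B"
    using B0 by (force simp: B_def dist_commute)+
  obtain A where A: "A \<in> sets M" "0 < emeasure M A" "emeasure M A < ennreal (\<epsilon> / B)"
    using M(2) \<epsilon> B unfolding has_small_events_def by (meson divide_pos_pos)
  define Y where "Y \<omega> = (if \<omega> \<in> A then z else X \<omega>)" for \<omega>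
  have Y: "Y \<in> M \<rightarrow>\<^sub>M ?R"
    unfolding Y_def using A X z by (intro measurable_If_set) (auto simp: space_restrict_space)
  have "mean_dist M X Y \<le> (\<integral>\<^sup>+\<omega>. ennreal B * indicator A \<omega> \<partial>M)"
    unfolding mean_dist_def
    by (rule nn_integral_mono)
       (use B random_variable_in[OF X] in \<open>auto simp: Y_def indicator_def intro!: ennreal_leI\<close>)
  also have "\<dots> = ennreal B * emeasure M A"
    using A by (simp add: nn_integral_cmult_indicator)
  also have "\<dots> < ennreal B * ennreal (\<epsilon> / B)"
    using A(3) B by (intro ennreal_mult_strict_left_mono) auto
  also have "\<dots> = ennreal \<epsilon>"
    using B \<epsilon> by (simp flip: ennreal_mult)
  finally have "mean_dist M X Y < ennreal \<epsilon>" .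
  moreover have "0 < measure (distr M ?R Y) (K \<inter> ball z \<kappa>)"
  proof -
    have "emeasure M A \<le> emeasure M (Y -` (K \<inter> ball z \<kappa>) \<inter> space M)"
      using A sets.sets_into_space[OF A(1)] z \<kappa> measurable_sets[OF Y open_in_sets_restrict[OF open_ball]]
      by (intro emeasure_mono) (auto simp: Y_def)
    also have "\<dots> = emeasure (distr M ?R Y) (K \<inter> ball z \<kappa>)"
      by (rule emeasure_distr[OF Y open_in_sets_restrict[OF open_ball], symmetric])
    finally have "0 < emeasure (distr M ?R Y) (K \<inter> ball z \<kappa>)" using A(2) by simp
    then show ?thesis
      using prob_space.finite_measure[OF prob_space_distr[OF Y]]
      by (simp add: finite_measure.emeasure_eq_measure)
  qed
  ultimately show "\<exists>Y\<in>M \<rightarrow>\<^sub>M ?R. mean_dist M X Y < ennreal \<epsilon> \<and>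
      distr M ?R Y \<in> {\<mu> \<in> prob_measures K. 0 < measure \<mu> (K \<inter> ball z \<kappa>)}"
    using Y distr_in_prob_measures[OF M(1) Y] by blast
qed

text \<open>
  Adding the complement of \<open>cball z \<kappa>\<close> makes the condition say nothing about the mass outside
  the ball where good centres are known to exist, while it remains a strict lower bound for
  the mass of an open set.
\<close>

definition mostly_sparsely_covered ::
  "'a::metric_space set \<Rightarrow> ('a \<Rightarrow> real \<Rightarrow> bool) \<Rightarrow> 'a \<Rightarrow> real \<Rightarrow> real \<Rightarrow> real \<Rightarrow> 'a measure set" where
  "mostly_sparsely_covered K P z \<kappa> \<epsilon> \<eta> = {\<mu> \<in> prob_measures K. \<exists>X r. sparse_cover K P \<epsilon> X r \<and>
     1 - \<eta> < measure \<mu> (K \<inter> ((\<Union>x\<in>X. ball x r) \<union> - cball z \<kappa>))}"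

lemma openin_mostly_sparsely_covered:
  fixes K :: "'a::metric_space set"
  shows "openin (weak_topology K) (mostly_sparsely_covered K P z \<kappa> \<epsilon> \<eta>)"
proof -
  have "mostly_sparsely_covered K P z \<kappa> \<epsilon> \<eta> = (\<Union>(X, r) \<in> {(X, r). sparse_cover K P \<epsilon> X r}.
      {\<mu> \<in> prob_measures K. 1 - \<eta> < measure \<mu> (K \<inter> ((\<Union>x\<in>X. ball x r) \<union> - cball z \<kappa>))})"
    unfolding mostly_sparsely_covered_def by auto
  also have "openin (weak_topology K) \<dots>"
    by (rule openin_Union) (auto intro!: openin_weak_topology_mass_gt open_Un open_UN simp: open_Compl)
  finally show ?thesis .
qed

text \<open>
  A random variable is rounded to a finite \<open>\<rho>\<close>-net, and then the points of the net in
  \<open>ball z \<kappa>\<close> are moved by less than \<open>\<rho>\<close> to good centres at a scale so small that the number of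
  these points is negligible. The points of the net outside \<open>ball z \<kappa>\<close> stay outside the
  smaller closed ball, so the new law is carried by the required open set.
\<close>

lemma coupling_dense_mostly_sparsely_covered:
  fixes K :: "'a::euclidean_space set"
  assumes K: "compact K" and z: "z \<in> K" and \<kappa>: "0 < \<kappa>'" "\<kappa>' < \<kappa>"
    and P: "attains_scales K P z \<kappa>" and \<epsilon>: "\<epsilon> > 0" and \<eta>: "\<eta> > 0"
  shows "coupling_dense K (mostly_sparsely_covered K P z \<kappa>' \<epsilon> \<eta>)"
  unfolding coupling_dense_def
proof (intro allI impI)
  fix M :: "('a \<times> real) measure" and X and e :: real
  let ?R = "restrict_space borel K"
  assume M: "prob_space M" and X: "X \<in> M \<rightarrow>\<^sub>M ?R" and e: "e > 0"
  interpret prob_space M by fact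
  define \<rho> where "\<rho> = e / 4"
  have \<rho>: "\<rho> > 0" using e by (simp add: \<rho>_def)
  obtain C where C: "C \<subseteq> K" "finite C" "K \<subseteq> (\<Union>y\<in>C. ball y \<rho>)"
    by (rule compactE_image[OF K, of K "\<lambda>y. ball y \<rho>"]) (use \<rho> in auto)
  \<comment> \<open>Adding \<open>z\<close> ensures that some point of the net lies in \<open>ball z \<kappa>\<close>.\<close>
  define F where "F = insert z C"
  define F1 where "F1 = F \<inter> ball z \<kappa>"
  have F: "finite F" "F \<noteq> {}" "F \<subseteq> K" and F1: "finite F1" "F1 \<noteq> {}" "F1 \<subseteq> K \<inter> ball z \<kappa>"
    using C z \<kappa> by (auto simp: F_def F1_def)
  have small: "\<forall>\<^sub>F r in at_right 0. r \<in> {0<..<\<epsilon>} \<and> real (card F1) \<le> r powr (- \<epsilon>)"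
    by (intro eventually_conj eventually_le_powr_neg eventually_at_right_real \<epsilon>)
  have "\<exists>\<^sub>F r in at_right 0. \<forall>y\<in>F1. \<exists>x\<in>K \<inter> ball y \<rho>. P x r"
    using P F1 \<rho> unfolding attains_scales_def by blast
  from frequently_ex[OF frequently_eventually_conj[OF this small]]
  obtain r where r: "0 < r" "r < \<epsilon>" "real (card F1) \<le> r powr (- \<epsilon>)"
    and "\<forall>y\<in>F1. \<exists>x\<in>K \<inter> ball y \<rho>. P x r" by auto
  then obtain b where b: "\<And>y. y \<in> F1 \<Longrightarrow> b y \<in> K \<inter> ball y \<rho> \<and> P (b y) r" by metis
  define h where "h y = (if y \<in> F1 then b y else y)" for y
  let ?f = "from_nat_into F"
  \<comment> \<open>Rounding to the first sufficiently close point in an enumeration is measurable.\<close>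
  define g where "g x = (LEAST i. dist (?f i) x < \<rho>)" for x
  have f_in: "?f i \<in> F" for i by (rule from_nat_into[OF F(2)])
  have hK: "h y \<in> K" and h_dist: "dist y (h y) < \<rho>" if "y \<in> F" for y
    using that b[of y] F \<rho> by (auto simp: h_def)
  have g: "dist (?f (g x)) x < \<rho>" if x: "x \<in> K" for x
  proof -
    obtain y where y: "y \<in> F" "dist y x < \<rho>" using subsetD[OF C(3) x] by (auto simp: F_def)
    obtain i where "?f i = y"
      using from_nat_into_surj[OF countable_finite[OF F(1)] y(1)] by blast
    then have "dist (?f i) x < \<rho>" using y by simp
    then show ?thesis unfolding g_def by (rule LeastI)
  qed
  define Y where "Y \<omega> = h (?f (g (X \<omega>)))" for \<omega>
  have [measurable]: "X \<in> borel_measurable M" by (rule random_variable_borel[OF X])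
  have gX: "(\<lambda>\<omega>. g (X \<omega>)) \<in> M \<rightarrow>\<^sub>M count_space UNIV"
    unfolding g_def by measurable
  have Y: "Y \<in> M \<rightarrow>\<^sub>M ?R"
    unfolding Y_def by (rule measurable_compose[OF gX]) (auto simp: space_restrict_space hK f_in)
  have "dist (X \<omega>) (Y \<omega>) \<le> e / 2" if "\<omega> \<in> space M" for \<omega>
  proof -
    have "dist (X \<omega>) (Y \<omega>) \<le> dist (?f (g (X \<omega>))) (X \<omega>) + dist (?f (g (X \<omega>))) (Y \<omega>)"
      using dist_triangle3 by blast
    also have "\<dots> \<le> \<rho> + \<rho>"
      using g[OF random_variable_in[OF X that]] h_dist[OF f_in, of "g (X \<omega>)"] by (simp add: Y_def)
    finally show ?thesis by (simp add: \<rho>_def)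
  qed
  then have "mean_dist M X Y \<le> (\<integral>\<^sup>+\<omega>. ennreal (e / 2) \<partial>M)"
    unfolding mean_dist_def by (intro nn_integral_mono ennreal_leI)
  also have "\<dots> = ennreal (e / 2)" by (simp add: emeasure_space_1)
  also have "\<dots> < ennreal e" using e by (simp add: ennreal_less_iff)
  finally have XY: "mean_dist M X Y < ennreal e" .
  have "sparse_cover K P \<epsilon> (b ` F1) r"
    using r b F1 card_image_le[OF F1(1), of b] unfolding sparse_cover_def by (auto intro: order_trans)
  moreover have "measure (distr M ?R Y) (K \<inter> ((\<Union>x\<in>b ` F1. ball x r) \<union> - cball z \<kappa>')) = 1"
  proof -
    let ?A = "K \<inter> ((\<Union>x\<in>b ` F1. ball x r) \<union> - cball z \<kappa>')"
    have A: "?A \<in> sets ?R"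
      by (intro open_in_sets_restrict open_Un open_UN) (auto simp: open_Compl)
    have "Y \<omega> \<in> ?A" if "\<omega> \<in> space M" for \<omega>
    proof -
      have "?f (g (X \<omega>)) \<notin> cball z \<kappa>'" if "?f (g (X \<omega>)) \<notin> F1"
        using that f_in \<kappa> by (auto simp: F1_def)
      then have "Y \<omega> \<in> b ` F1 \<or> Y \<omega> \<notin> cball z \<kappa>'" by (auto simp: Y_def h_def)
      moreover have "Y \<omega> \<in> K" by (rule random_variable_in[OF Y that])
      ultimately show ?thesis using r by force
    qed
    then have "Y -` ?A \<inter> space M = space M" by blast
    then show ?thesis using measure_distr[OF Y A] prob_space by simp
  qed
  ultimately have "distr M ?R Y \<in> mostly_sparsely_covered K P z \<kappa>' \<epsilon> \<eta>"
    using distr_in_prob_measures[OF M Y] \<eta> unfolding mostly_sparsely_covered_def by force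
  then show "\<exists>Y\<in>M \<rightarrow>\<^sub>M ?R. mean_dist M X Y < ennreal e \<and>
      distr M ?R Y \<in> mostly_sparsely_covered K P z \<kappa>' \<epsilon> \<eta>"
    using XY Y by blast
qed

lemma sparse_cover_mono:
  assumes "sparse_cover K P \<epsilon> X r" "\<epsilon> \<le> \<epsilon>'" "\<epsilon> \<le> 1"
  shows "sparse_cover K P \<epsilon>' X r"
proof -
  have "r powr (- \<epsilon>) \<le> r powr (- \<epsilon>')"
    using assms by (intro powr_mono') (auto simp: sparse_cover_def)
  then show ?thesis using assms unfolding sparse_cover_def by auto
qed

text \<open>
  With \<open>\<eta> = 2^(-n)\<close> the exceptional masses are summable, so discarding the exceptional sets of
  index at least \<open>m\<close> leaves part of the mass of \<open>ball z (\<kappa> / 2)\<close> when \<open>m\<close> is large. What is left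
  in this ball is covered by every one of the remaining sparse families.
\<close>

lemma sparsely_coverable_residual:
  fixes K :: "'a::euclidean_space set"
  assumes K: "compact K" and z: "z \<in> K" and \<kappa>: "0 < \<kappa>" and P: "attains_scales K P z \<kappa>"
  shows "coupling_residual K (\<lambda>\<mu>. \<exists>E\<in>sets \<mu>. 0 < emeasure \<mu> E \<and> sparsely_coverable K P E)"
proof -
  let ?V = "{\<mu> \<in> prob_measures K. 0 < measure \<mu> (K \<inter> ball z (\<kappa> / 2))}"
  let ?U = "\<lambda>n. mostly_sparsely_covered K P z (\<kappa> / 2) (1 / real (Suc n)) ((1 / 2) ^ n)"
  have "\<exists>E\<in>sets \<mu>. 0 < emeasure \<mu> E \<and> sparsely_coverable K P E"
    if "\<mu> \<in> prob_measures K \<inter> \<Inter>(insert ?V (range ?U))" for \<mu>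
  proof -
    have \<mu>: "\<mu> \<in> prob_measures K" and V: "0 < measure \<mu> (K \<inter> ball z (\<kappa> / 2))"
      and U: "\<And>n. \<mu> \<in> ?U n" using that by auto
    interpret prob_space \<mu> by (rule prob_measuresD[OF \<mu>])
    note S = prob_measuresD(2,3)[OF \<mu>]
    have "\<forall>n. \<exists>X r. sparse_cover K P (1 / real (Suc n)) X r \<and>
        1 - (1 / 2) ^ n < measure \<mu> (K \<inter> ((\<Union>x\<in>X. ball x r) \<union> - cball z (\<kappa> / 2)))"
      using U unfolding mostly_sparsely_covered_def by blast
    then obtain X r where X: "\<And>n. sparse_cover K P (1 / real (Suc n)) (X n) (r n)"
      and mX: "\<And>n. 1 - (1 / 2) ^ n < measure \<mu> (K \<inter> ((\<Union>x\<in>X n. ball x (r n)) \<union> - cball z (\<kappa> / 2)))"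
      by metis
    define A where "A n = K \<inter> ((\<Union>x\<in>X n. ball x (r n)) \<union> - cball z (\<kappa> / 2))" for n
    have A: "A n \<in> sets \<mu>" for n
      unfolding S A_def by (intro open_in_sets_restrict open_Un open_UN) (auto simp: open_Compl)
    have B: "K \<inter> ball z (\<kappa> / 2) \<in> sets \<mu>"
      unfolding S by (rule open_in_sets_restrict) simp
    obtain m where m: "(1 / 2 :: real) ^ m < measure \<mu> (K \<inter> ball z (\<kappa> / 2)) / 2"
      using real_arch_pow_inv[of "measure \<mu> (K \<inter> ball z (\<kappa> / 2)) / 2" "1 / 2"] V by auto
    define N where "N = (\<Union>k. space \<mu> - A (m + k))"
    have N: "N \<in> sets \<mu>" unfolding N_def using A by auto
    have "emeasure \<mu> N \<le> (\<Sum>k. emeasure \<mu> (space \<mu> - A (m + k)))"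
      unfolding N_def using A by (intro emeasure_subadditive_countably) auto
    also have "\<dots> \<le> ennreal (2 * (1 / 2) ^ m)"
    proof (rule suminf_geometric_le)
      fix k
      have "measure \<mu> (space \<mu> - A (m + k)) = 1 - measure \<mu> (A (m + k))"
        by (rule prob_compl[OF A])
      also have "\<dots> \<le> (1 / 2) ^ (m + k)" using mX[of "m + k"] by (simp add: A_def)
      finally show "emeasure \<mu> (space \<mu> - A (m + k)) \<le> ennreal ((1 / 2) ^ m * (1 / 2) ^ k)"
        by (simp add: emeasure_eq_measure power_add ennreal_leI)
    qed simp
    also have "\<dots> < emeasure \<mu> (K \<inter> ball z (\<kappa> / 2))"
      using m by (simp add: emeasure_eq_measure ennreal_less_iff)
    finally have less: "emeasure \<mu> N < emeasure \<mu> (K \<inter> ball z (\<kappa> / 2))" .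
    define E where "E = (K \<inter> ball z (\<kappa> / 2)) - N"
    have E: "E \<in> sets \<mu>" unfolding E_def using B N by auto
    have "emeasure \<mu> (K \<inter> ball z (\<kappa> / 2)) \<le> emeasure \<mu> (E \<union> N)"
      using sets.Un[OF B N] by (intro emeasure_mono) (auto simp: E_def)
    also have "\<dots> \<le> emeasure \<mu> E + emeasure \<mu> N"
      by (rule emeasure_subadditive[OF E N])
    finally have "emeasure \<mu> E \<noteq> 0" using less by auto
    then have pos: "0 < emeasure \<mu> E" by (simp add: zero_less_iff_neq_zero)
    have "sparsely_coverable K P E"
      unfolding sparsely_coverable_def
    proof (intro allI impI)
      fix \<epsilon> :: real assume "\<epsilon> > 0"
      then obtain n where n: "1 / real (Suc n) < \<epsilon>" using nat_approx_posE by blast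
      have "1 / real (Suc (m + n)) \<le> 1 / real (Suc n)" by (simp add: field_simps)
      then have "1 / real (Suc (m + n)) \<le> \<epsilon>" using n by linarith
      then have sc: "sparse_cover K P \<epsilon> (X (m + n)) (r (m + n))"
        by (intro sparse_cover_mono[OF X]) (auto simp: field_simps)
      have "space \<mu> - A (m + n) \<subseteq> N" unfolding N_def by blast
      then have "E \<subseteq> A (m + n)" using S(2) by (auto simp: E_def)
      moreover have "E \<subseteq> cball z (\<kappa> / 2)" by (auto simp: E_def)
      ultimately have "E \<subseteq> (\<Union>x\<in>X (m + n). ball x (r (m + n)))" by (auto simp: A_def)
      then show "\<exists>X r. sparse_cover K P \<epsilon> X r \<and> E \<subseteq> (\<Union>x\<in>X. ball x r)" using sc by blast
    qed
    then show ?thesis using E pos by blast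
  qed
  moreover have "openin (weak_topology K) U \<and> coupling_dense K U" if "U \<in> insert ?V (range ?U)" for U
    using that K z \<kappa> P openin_weak_topology_mass_gt[OF open_ball, of K 0 z "\<kappa> / 2"]
      coupling_dense_ball_pos[of K z "\<kappa> / 2"] openin_mostly_sparsely_covered
      coupling_dense_mostly_sparsely_covered[OF K z _ _ P, of "\<kappa> / 2"]
    by auto
  ultimately show ?thesis
    unfolding coupling_residual_def by (intro exI[of _ "insert ?V (range ?U)"]) auto
qed

section \<open>Masses of balls and covering moments\<close>

lemma ext_ln_ge:
  assumes "0 < c" "ennreal c \<le> t" shows "ereal (ln c) \<le> ext_ln t"
  using assms by (cases t) (auto simp: ext_ln_def)

lemma ext_ln_le:
  assumes "0 < c" "t \<le> ennreal c" shows "ext_ln t \<le> ereal (ln c)"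
  using assms by (cases t) (auto simp: ext_ln_def top_unique)

text \<open>
  Division by \<open>ln r < 0\<close> reverses inequalities, so exponents above \<open>t\<close> mean masses below
  \<open>r powr t\<close>.
\<close>

lemma less_powr_if_exponent_greater:
  assumes r: "0 < r" "r < 1" and t: "ereal t < ext_ln m / ereal (ln r)"
  shows "m < ennreal (r powr t)"
proof (rule ccontr)
  assume "\<not> ?thesis"
  then have "ereal (t * ln r) \<le> ext_ln m"
    using ext_ln_ge[of "r powr t" m] r by (simp add: ln_powr not_less)
  then have "ext_ln m / ereal (ln r) \<le> ereal t"
    using r by (cases "ext_ln m") (auto simp: field_simps divide_less_0_iff)
  then show False using t by simp
qed

lemma greater_powr_if_exponent_less:
  assumes r: "0 < r" "r < 1" and t: "ext_ln m / ereal (ln r) < ereal t"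
  shows "ennreal (r powr t) < m"
proof (rule ccontr)
  assume "\<not> ?thesis"
  then have "ext_ln m \<le> ereal (t * ln r)"
    using ext_ln_le[of "r powr t" m] r by (simp add: ln_powr not_less)
  then have "ereal t \<le> ext_ln m / ereal (ln r)"
    using r by (cases "ext_ln m") (auto simp: field_simps divide_less_0_iff)
  then show False using t by simp
qed

lemma covering_moment_ge_term:
  assumes E: "E \<noteq> {}" and c: "\<And>x. x \<in> K \<Longrightarrow> c \<le> measure \<pi> (ball x r) powr q"
  shows "ennreal c \<le> covering_moment \<pi> K q E r"
  unfolding covering_moment_def
proof (rule INF_greatest, clarify)
  fix I :: "nat set" and x assume x: "x ` I \<subseteq> K" "E \<subseteq> (\<Union>i\<in>I. ball (x i) r)"
  then obtain i where i: "i \<in> I" using E by blast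
  let ?g = "\<lambda>i. ennreal (measure \<pi> (ball (x i) r) powr q)"
  have "ennreal c \<le> ?g i" using c x i by (intro ennreal_leI) auto
  also have "\<dots> = infsum ?g {i}" by simp
  also have "\<dots> \<le> infsum ?g I"
    by (rule infsum_mono_neutral) (use i in \<open>auto intro: nonneg_summable_on_complete\<close>)
  finally show "ennreal c \<le> infsum ?g I" .
qed

lemma covering_moment_le_card:
  assumes X: "finite X" "X \<subseteq> K" "E \<subseteq> (\<Union>x\<in>X. ball x r)"
    and c: "\<And>x. x \<in> X \<Longrightarrow> measure \<pi> (ball x r) powr q \<le> c" "0 \<le> c"
  shows "covering_moment \<pi> K q E r \<le> ennreal (real (card X) * c)"
proof -
  obtain h where h: "bij_betw h {0..<card X} X"
    using ex_bij_betw_nat_finite[OF X(1)] by blast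
  let ?g = "\<lambda>i. ennreal (measure \<pi> (ball (h i) r) powr q)"
  have im: "h ` {0..<card X} = X" using h by (simp add: bij_betw_def)
  have "E \<subseteq> (\<Union>i\<in>{0..<card X}. ball (h i) r)"
  proof
    fix e assume "e \<in> E"
    then obtain x where x: "x \<in> X" "e \<in> ball x r" using X(3) by blast
    then obtain i where "i \<in> {0..<card X}" "x = h i" using im by blast
    then show "e \<in> (\<Union>i\<in>{0..<card X}. ball (h i) r)" using x by blast
  qed
  then have "({0..<card X}, h) \<in> {(I, x). x ` I \<subseteq> K \<and> E \<subseteq> (\<Union>i\<in>I. ball (x i) r)}"
    using X(2) im by simp
  then have "covering_moment \<pi> K q E r \<le> infsum ?g {0..<card X}"
    unfolding covering_moment_def
    by (rule INF_lower2) simp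
  also have "\<dots> = (\<Sum>i\<in>{0..<card X}. ?g i)" by simp
  also have "\<dots> \<le> (\<Sum>i\<in>{0..<card X}. ennreal c)"
    using c(1) im by (intro sum_mono ennreal_leI) blast
  also have "\<dots> = ennreal (real (card X) * c)"
    using c by (simp add: ennreal_mult ennreal_of_nat_eq_real_of_nat)
  finally show ?thesis .
qed

lemma lower_box_dim_ge:
  assumes E: "E \<noteq> {}"
    and ev: "\<forall>\<^sub>F r in at_right 0. \<forall>x\<in>K. r powr s \<le> measure \<pi> (ball x r) powr q"
  shows "ereal (- s) \<le> lower_box_dim \<pi> K q E"
  unfolding lower_box_dim_def
proof (rule Liminf_bounded)
  have "\<forall>\<^sub>F r in at_right (0::real). r \<in> {0<..<1}" by (rule eventually_at_right_real) simp
  with ev show "\<forall>\<^sub>F r in at_right 0. ereal (- s) \<le> ext_ln (covering_moment \<pi> K q E r) / ereal (- ln r)"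
  proof eventually_elim
    case (elim r)
    then have "ereal (s * ln r) \<le> ext_ln (covering_moment \<pi> K q E r)"
      using ext_ln_ge[OF _ covering_moment_ge_term[OF E], of "r powr s" K \<pi> r q] by (simp add: ln_powr)
    then show ?case
      using elim by (cases "ext_ln (covering_moment \<pi> K q E r)") (auto simp: field_simps)
  qed
qed

text \<open>
  At the scale \<open>r\<close> of a sparse cover the moment is at most \<open>r powr (- \<epsilon>) * r powr s\<close>. Such
  scales are arbitrarily small, which is enough to bound a limit inferior.
\<close>

lemma lower_box_dim_le_if_sparsely_coverable:
  assumes E: "sparsely_coverable K P E"
    and P: "\<And>x r. 0 < r \<Longrightarrow> r < 1 \<Longrightarrow> x \<in> K \<Longrightarrow> P x r \<Longrightarrow> measure \<pi> (ball x r) powr q \<le> r powr s"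
  shows "lower_box_dim \<pi> K q E \<le> ereal (- s)"
proof (rule ereal_le_epsilon2)
  fix e :: real assume e: "0 < e"
  show "lower_box_dim \<pi> K q E \<le> ereal (- s) + ereal e"
  proof (rule ccontr)
    assume "\<not> ?thesis"
    then have "ereal (- s + e) < lower_box_dim \<pi> K q E" by simp
    from less_LiminfD[OF this[unfolded lower_box_dim_def]]
    obtain b where b: "b > 0" "\<And>r. 0 < r \<Longrightarrow> r < b \<Longrightarrow>
        ereal (- s + e) < ext_ln (covering_moment \<pi> K q E r) / ereal (- ln r)"
      unfolding eventually_at_right_field by auto
    define \<epsilon> where "\<epsilon> = min 1 (min e b)"
    have \<epsilon>: "\<epsilon> > 0" "\<epsilon> \<le> 1" "\<epsilon> \<le> e" "\<epsilon> \<le> b" using e b by (auto simp: \<epsilon>_def)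
    obtain X r where X: "sparse_cover K P \<epsilon> X r" "E \<subseteq> (\<Union>x\<in>X. ball x r)"
      using E \<epsilon> unfolding sparsely_coverable_def by blast
    then have r: "0 < r" "r < \<epsilon>" "r < 1" "real (card X) \<le> r powr (- \<epsilon>)"
      using \<epsilon> by (auto simp: sparse_cover_def)
    have "covering_moment \<pi> K q E r \<le> ennreal (real (card X) * r powr s)"
      using X r P by (intro covering_moment_le_card) (auto simp: sparse_cover_def)
    also have "\<dots> \<le> ennreal (r powr (- \<epsilon>) * r powr s)"
      using r by (intro ennreal_leI mult_right_mono) auto
    also have "\<dots> = ennreal (r powr (s - \<epsilon>))" by (simp flip: powr_add)
    finally have "ext_ln (covering_moment \<pi> K q E r) \<le> ereal ((s - \<epsilon>) * ln r)"
      using ext_ln_le[of "r powr (s - \<epsilon>)"] r by (simp add: ln_powr)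
    then have "ext_ln (covering_moment \<pi> K q E r) / ereal (- ln r) \<le> ereal (- s + \<epsilon>)"
      using r by (cases "ext_ln (covering_moment \<pi> K q E r)") (auto simp: field_simps)
    also have "\<dots> \<le> ereal (- s + e)" using \<epsilon> by simp
    finally show False using b(2)[of r] r \<epsilon> by (simp add: not_less[symmetric])
  qed
qed

section \<open>Exponents of the reference measure\<close>

lemma finite_config_enum:
  assumes "finite F" "F \<noteq> {}" "F \<subseteq> K \<inter> ball z \<kappa>" "0 < \<rho>"
  obtains N y where "(N, y, \<rho>) \<in> finite_configs K z \<kappa>" "y ` {1..N} = F"
proof -
  obtain h where "bij_betw h {1..card F} F"
    using ex_bij_betw_nat_finite_1[OF assms(1)] by blast
  moreover have "card F \<ge> 1" using assms by (simp add: Suc_le_eq card_gt_0_iff)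
  moreover from calculation have "h i \<in> K \<inter> ball z \<kappa>" if "i \<in> {1..card F}" for i
    using that assms(3) unfolding bij_betw_def by blast
  ultimately show ?thesis
    using that[of "card F" h] assms(4) unfolding finite_configs_def bij_betw_def by auto
qed

text \<open>
  The infimum over \<open>i\<close> stands inside the limit superior, so at arbitrarily small scales all
  points of a configuration have local exponent above \<open>t\<close> at once; each then has a centre of
  mass below \<open>r powr t\<close> nearby. The choice of the ball \<open>B(z,\<kappa>)\<close> realises the outer supremum.
\<close>

lemma attains_scales_if_less_upper_D_unif_max:
  assumes t: "ereal t < upper_D_unif_max \<pi> K"
  obtains z \<kappa> where "z \<in> K" "0 < \<kappa>"
    "attains_scales K (\<lambda>x r. emeasure \<pi> (ball x r) < ennreal (r powr t)) z \<kappa>"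
proof -
  obtain z \<kappa> where z: "z \<in> K" "0 < \<kappa>" and less: "ereal t < (INF (N, y, \<rho>) \<in> finite_configs K z \<kappa>.
        Limsup (at_right 0) (\<lambda>r. INF i\<in>{1..N}. inf_local_exponent \<pi> K (y i) \<rho> r))"
    using t unfolding upper_D_unif_max_def less_SUP_iff by auto
  have "attains_scales K (\<lambda>x r. emeasure \<pi> (ball x r) < ennreal (r powr t)) z \<kappa>"
    unfolding attains_scales_def
  proof (intro allI impI)
    fix F \<rho> assume "finite F" "F \<noteq> {}" "F \<subseteq> K \<inter> ball z \<kappa>" "0 < (\<rho>::real)"
    then obtain N y where y: "(N, y, \<rho>) \<in> finite_configs K z \<kappa>" "y ` {1..N} = F"
      by (rule finite_config_enum)
    let ?g = "\<lambda>r. INF i\<in>{1..N}. inf_local_exponent \<pi> K (y i) \<rho> r"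
    have "ereal t < Limsup (at_right 0) ?g"
      using less_INF_D[OF less y(1)] by simp
    then have "\<exists>\<^sub>F r in at_right 0. ereal t < ?g r"
      using Limsup_bounded[of ?g "ereal t" "at_right 0"]
      by (auto simp: frequently_def not_less simp flip: not_le)
    moreover have "\<forall>\<^sub>F r in at_right (0::real). r \<in> {0<..<1}" by (rule eventually_at_right_real) simp
    ultimately have "\<exists>\<^sub>F r in at_right 0. r \<in> {0<..<1} \<and> ereal t < ?g r"
      by (rule frequently_eventually_conj)
    then show "\<exists>\<^sub>F r in at_right 0. \<forall>y\<in>F. \<exists>x\<in>K \<inter> ball y \<rho>. emeasure \<pi> (ball x r) < ennreal (r powr t)"
    proof (rule frequently_elim1)
      fix r assume r: "r \<in> {0<..<1} \<and> ereal t < ?g r"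
      have "\<exists>x\<in>K \<inter> ball (y i) \<rho>. emeasure \<pi> (ball x r) < ennreal (r powr t)" if "i \<in> {1..N}" for i
      proof -
        have "ereal t < inf_local_exponent \<pi> K (y i) \<rho> r"
          using r less_INF_D[OF _ that] by blast
        from less_powr_if_exponent_greater[OF _ _ this[unfolded inf_local_exponent_def]]
        show ?thesis using r by (simp add: INF_less_iff)
      qed
      then show "\<forall>y\<in>F. \<exists>x\<in>K \<inter> ball y \<rho>. emeasure \<pi> (ball x r) < ennreal (r powr t)"
        unfolding y(2)[symmetric] by blast
    qed
  qed
  then show ?thesis using that z by blast
qed

lemma attains_scales_if_greater_lower_D_unif_min:
  assumes t: "lower_D_unif_min \<pi> K < ereal t"
  obtains z \<kappa> where "z \<in> K" "0 < \<kappa>"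
    "attains_scales K (\<lambda>x r. ennreal (r powr t) < emeasure \<pi> (ball x r)) z \<kappa>"
proof -
  obtain z \<kappa> where z: "z \<in> K" "0 < \<kappa>" and less: "(SUP (N, y, \<rho>) \<in> finite_configs K z \<kappa>.
        Liminf (at_right 0) (\<lambda>r. SUP i\<in>{1..N}. sup_local_exponent \<pi> K (y i) \<rho> r)) < ereal t"
    using t unfolding lower_D_unif_min_def INF_less_iff by auto
  have "attains_scales K (\<lambda>x r. ennreal (r powr t) < emeasure \<pi> (ball x r)) z \<kappa>"
    unfolding attains_scales_def
  proof (intro allI impI)
    fix F \<rho> assume "finite F" "F \<noteq> {}" "F \<subseteq> K \<inter> ball z \<kappa>" "0 < (\<rho>::real)"
    then obtain N y where y: "(N, y, \<rho>) \<in> finite_configs K z \<kappa>" "y ` {1..N} = F"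
      by (rule finite_config_enum)
    let ?g = "\<lambda>r. SUP i\<in>{1..N}. sup_local_exponent \<pi> K (y i) \<rho> r"
    have "Liminf (at_right 0) ?g < ereal t"
      using SUP_lessD[OF less y(1)] by simp
    then have "\<exists>\<^sub>F r in at_right 0. ?g r < ereal t"
      using Liminf_bounded[of "ereal t" ?g "at_right 0"]
      by (auto simp: frequently_def not_less simp flip: not_le)
    moreover have "\<forall>\<^sub>F r in at_right (0::real). r \<in> {0<..<1}" by (rule eventually_at_right_real) simp
    ultimately have "\<exists>\<^sub>F r in at_right 0. r \<in> {0<..<1} \<and> ?g r < ereal t"
      by (rule frequently_eventually_conj)
    then show "\<exists>\<^sub>F r in at_right 0. \<forall>y\<in>F. \<exists>x\<in>K \<inter> ball y \<rho>. ennreal (r powr t) < emeasure \<pi> (ball x r)"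
    proof (rule frequently_elim1)
      fix r assume r: "r \<in> {0<..<1} \<and> ?g r < ereal t"
      have "\<exists>x\<in>K \<inter> ball (y i) \<rho>. ennreal (r powr t) < emeasure \<pi> (ball x r)" if "i \<in> {1..N}" for i
      proof -
        have "sup_local_exponent \<pi> K (y i) \<rho> r < ereal t"
          using r SUP_lessD[OF _ that] by blast
        from greater_powr_if_exponent_less[OF _ _ this[unfolded sup_local_exponent_def]]
        show ?thesis using r by (simp add: less_SUP_iff)
      qed
      then show "\<forall>y\<in>F. \<exists>x\<in>K \<inter> ball y \<rho>. ennreal (r powr t) < emeasure \<pi> (ball x r)"
        unfolding y(2)[symmetric] by blast
    qed
  qed
  then show ?thesis using that z by blast
qed

lemma attains_scales_trivial: "attains_scales K (\<lambda>_ _. True) z \<kappa>"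
  unfolding attains_scales_def
proof (intro allI impI)
  fix F \<rho> assume F: "F \<subseteq> K \<inter> ball z \<kappa>" "0 < (\<rho>::real)"
  then have "\<forall>y\<in>F. \<exists>x\<in>K \<inter> ball y \<rho>. True" by force
  then show "\<exists>\<^sub>F r in at_right (0::real). \<forall>y\<in>F. \<exists>x\<in>K \<inter> ball y \<rho>. True" by simp
qed

text \<open>
  A ball \<open>B(y,\<rho>)\<close> that contains all of \<open>K\<close> is one of the competitors in the supremum that
  defines \<open>upper_D_max\<close>, and its local exponent controls the masses at all points of \<open>K\<close>.
\<close>

lemma eventually_mass_greater_if_upper_D_max_less:
  assumes K: "bounded K" and t: "upper_D_max \<pi> K < ereal t"
  shows "\<forall>\<^sub>F r in at_right 0. \<forall>x\<in>K. ennreal (r powr t) < emeasure \<pi> (ball x r)"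
proof (cases "K = {}")
  case False
  then obtain y where y: "y \<in> K" by blast
  obtain \<rho> where \<rho>: "0 < \<rho>" "K \<subseteq> ball y \<rho>"
    using bounded_subset_ballD[OF K] by blast
  have "Limsup (at_right 0) (\<lambda>r. inf_local_exponent \<pi> K y \<rho> r) \<le> upper_D_max \<pi> K"
    unfolding upper_D_max_def by (rule SUP_upper2[of "(y, \<rho>)"]) (use y \<rho> in auto)
  then have "\<forall>\<^sub>F r in at_right 0. inf_local_exponent \<pi> K y \<rho> r < ereal t"
    using t by (intro Limsup_lessD) (rule le_less_trans)
  moreover have "\<forall>\<^sub>F r in at_right (0::real). r \<in> {0<..<1}" by (rule eventually_at_right_real) simp
  ultimately show ?thesis
  proof eventually_elim
    case (elim r)
    then have "ennreal (r powr t) < (INF x\<in>K \<inter> ball y \<rho>. emeasure \<pi> (ball x r))"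
      using greater_powr_if_exponent_less unfolding inf_local_exponent_def by simp
    then show ?case using \<rho> less_INF_D by fastforce
  qed
qed simp

lemma eventually_mass_less_if_lower_D_min_greater:
  assumes K: "bounded K" and t: "ereal t < lower_D_min \<pi> K"
  shows "\<forall>\<^sub>F r in at_right 0. \<forall>x\<in>K. emeasure \<pi> (ball x r) < ennreal (r powr t)"
proof (cases "K = {}")
  case False
  then obtain y where y: "y \<in> K" by blast
  obtain \<rho> where \<rho>: "0 < \<rho>" "K \<subseteq> ball y \<rho>"
    using bounded_subset_ballD[OF K] by blast
  have "lower_D_min \<pi> K \<le> Liminf (at_right 0) (\<lambda>r. sup_local_exponent \<pi> K y \<rho> r)"
    unfolding lower_D_min_def by (rule INF_lower2[of "(y, \<rho>)"]) (use y \<rho> in auto)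
  then have "\<forall>\<^sub>F r in at_right 0. ereal t < sup_local_exponent \<pi> K y \<rho> r"
    using t by (intro less_LiminfD) (rule less_le_trans)
  moreover have "\<forall>\<^sub>F r in at_right (0::real). r \<in> {0<..<1}" by (rule eventually_at_right_real) simp
  ultimately show ?thesis
  proof eventually_elim
    case (elim r)
    then have "(SUP x\<in>K \<inter> ball y \<rho>. emeasure \<pi> (ball x r)) < ennreal (r powr t)"
      using less_powr_if_exponent_greater unfolding sup_local_exponent_def by simp
    then show ?case using \<rho> SUP_lessD by fastforce
  qed
qed simp

section \<open>Bounds for the small lower dimension\<close>

text \<open>
  The next few lemmas pass from rational exponents to extended real ones, including infinite
  values; countably many exponents suffice for the generic upper bounds.
\<close>

lemma rat_between_ereal:
  assumes "(a::ereal) < b" obtains t where "t \<in> \<rat>" "a < ereal t" "ereal t < b"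
  using ereal_dense3[OF assms] Rats_of_rat by blast

lemma le_scaled_if_le_rats_below:
  assumes q: "q > 0" and le: "\<And>t. t \<in> \<rat> \<Longrightarrow> ereal t < D \<Longrightarrow> S \<le> ereal (- (q * t))"
  shows "S \<le> ereal (- q) * D"
proof (rule dense_ge)
  fix y assume y: "ereal (- q) * D < y"
  show "S \<le> y"
  proof (cases y)
    case (real u)
    then have "ereal (- u / q) < D" using y q by (cases D) (auto simp: field_simps)
    then obtain t where t: "t \<in> \<rat>" "ereal (- u / q) < ereal t" "ereal t < D"
      by (rule rat_between_ereal)
    have "- (q * t) \<le> u" using t(2) q by (simp add: field_simps)
    then show ?thesis using le[OF t(1,3)] real order_trans by fastforce
  qed (use y in auto)
qed

lemma le_scaled_if_le_rats_above:
  assumes q: "q < 0" and le: "\<And>t. t \<in> \<rat> \<Longrightarrow> D < ereal t \<Longrightarrow> S \<le> ereal (- (q * t))"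
  shows "S \<le> ereal (- q) * D"
proof -
  have "S \<le> ereal (- (- q)) * - D"
  proof (rule le_scaled_if_le_rats_below)
    fix t :: real assume "t \<in> \<rat>" "ereal t < - D"
    then show "S \<le> ereal (- (- q * t))"
      using le[of "- t"] by (simp add: ereal_less_uminus_reorder)
  qed (use q in simp)
  then show ?thesis by (simp flip: uminus_ereal.simps)
qed

lemma scaled_le_if_rats_above_le:
  assumes q: "q > 0" and le: "\<And>t. t \<in> \<rat> \<Longrightarrow> D < ereal t \<Longrightarrow> ereal (- (q * t)) \<le> S"
  shows "ereal (- q) * D \<le> S"
proof -
  have "- S \<le> ereal (- (- q)) * D"
  proof (rule le_scaled_if_le_rats_above)
    show "- S \<le> ereal (- (- q * t))" if "t \<in> \<rat>" "D < ereal t" for t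
      using le[OF that] by (cases S) auto
  qed (use q in simp)
  then show ?thesis by (simp add: ereal_uminus_le_reorder flip: uminus_ereal.simps)
qed

lemma scaled_le_if_rats_below_le:
  assumes q: "q < 0" and le: "\<And>t. t \<in> \<rat> \<Longrightarrow> ereal t < D \<Longrightarrow> ereal (- (q * t)) \<le> S"
  shows "ereal (- q) * D \<le> S"
proof -
  have "- S \<le> ereal (- (- q)) * D"
  proof (rule le_scaled_if_le_rats_below)
    show "- S \<le> ereal (- (- q * t))" if "t \<in> \<rat>" "ereal t < D" for t
      using le[OF that] by (cases S) auto
  qed (use q in simp)
  then show ?thesis by (simp add: ereal_uminus_le_reorder flip: uminus_ereal.simps)
qed

lemma measure_ball_support_pos:
  fixes \<pi> :: "'a::metric_space measure"
  assumes "prob_space \<pi>" "x \<in> measure_support \<pi>" "0 < r"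
  shows "0 < measure \<pi> (ball x r)"
proof -
  interpret prob_space \<pi> by fact
  have "0 < emeasure \<pi> (ball x r)"
    using assms by (simp add: measure_support_def)
  then show ?thesis by (simp add: emeasure_eq_measure)
qed

lemma small_lower_box_dim_le_if_sparsely_coverable:
  assumes cov: "\<exists>E\<in>sets \<mu>. 0 < emeasure \<mu> E \<and> sparsely_coverable K P E"
    and P: "\<And>x r. 0 < r \<Longrightarrow> r < 1 \<Longrightarrow> x \<in> K \<Longrightarrow> P x r \<Longrightarrow> measure \<pi> (ball x r) powr q \<le> r powr s"
  shows "small_lower_box_dim \<pi> K q \<mu> \<le> ereal (- s)"
proof -
  obtain E where E: "E \<in> sets \<mu>" "0 < emeasure \<mu> E" "sparsely_coverable K P E"
    using cov by blast
  have "lower_box_dim \<pi> K q E \<le> ereal (- s)"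
    using E(3) P by (rule lower_box_dim_le_if_sparsely_coverable)
  then show ?thesis
    unfolding small_lower_box_dim_def using E by (intro INF_lower2[of E]) auto
qed

lemma small_lower_box_dim_ge:
  assumes "\<forall>\<^sub>F r in at_right 0. \<forall>x\<in>K. r powr s \<le> measure \<pi> (ball x r) powr q"
  shows "ereal (- s) \<le> small_lower_box_dim \<pi> K q \<mu>"
  unfolding small_lower_box_dim_def
proof (rule INF_greatest)
  fix E assume "E \<in> {E \<in> sets \<mu>. emeasure \<mu> E > 0}"
  then have "E \<noteq> {}" by auto
  then show "ereal (- s) \<le> lower_box_dim \<pi> K q E" by (rule lower_box_dim_ge[OF _ assms])
qed

text \<open>
  For \<open>q = 0\<close> the moment counts balls, because every ball with centre in the support has positive
  mass, so that its power of order \<open>0\<close> is \<open>1\<close> (in contrast to \<open>0 powr 0 = 0\<close>).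
\<close>

lemma small_lower_box_dim_0_nonneg:
  assumes \<pi>: "prob_space \<pi>" and K: "K \<subseteq> measure_support \<pi>"
  shows "0 \<le> small_lower_box_dim \<pi> K 0 \<mu>"
proof -
  have "\<forall>\<^sub>F r in at_right 0. \<forall>x\<in>K. r powr 0 \<le> measure \<pi> (ball x r) powr 0"
    using eventually_at_right_less[of "0::real"]
  proof eventually_elim
    case (elim r)
    then show ?case
      using measure_ball_support_pos[OF \<pi>, of _ r] K by fastforce
  qed
  from small_lower_box_dim_ge[OF this] show ?thesis by (simp add: zero_ereal_def)
qed

lemma small_lower_box_dim_ge_upper_D_max:
  assumes \<pi>: "prob_space \<pi>" and K: "bounded K" and q: "0 < q"
  shows "ereal (- q) * upper_D_max \<pi> K \<le> small_lower_box_dim \<pi> K q \<mu>"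
proof -
  interpret prob_space \<pi> by fact
  show ?thesis
  proof (rule scaled_le_if_rats_above_le)
    fix t assume "upper_D_max \<pi> K < ereal t"
    from eventually_mass_greater_if_upper_D_max_less[OF K this]
    have "\<forall>\<^sub>F r in at_right 0. \<forall>x\<in>K. r powr (q * t) \<le> measure \<pi> (ball x r) powr q"
    proof eventually_elim
      case (elim r)
      have "r powr (q * t) \<le> measure \<pi> (ball x r) powr q" if "x \<in> K" for x
      proof -
        have "r powr t \<le> measure \<pi> (ball x r)"
          using elim that by (fastforce simp: emeasure_eq_measure ennreal_less_iff)
        then have "(r powr t) powr q \<le> measure \<pi> (ball x r) powr q"
          using q by (intro powr_mono2) auto
        then show ?thesis by (simp add: powr_powr mult.commute)
      qed
      then show ?case by blast
    qed
    then show "ereal (- (q * t)) \<le> small_lower_box_dim \<pi> K q \<mu>" by (rule small_lower_box_dim_ge)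
  qed (use q in simp)
qed

lemma small_lower_box_dim_ge_lower_D_min:
  assumes \<pi>: "prob_space \<pi>" and K: "bounded K" "K \<subseteq> measure_support \<pi>" and q: "q < 0"
  shows "ereal (- q) * lower_D_min \<pi> K \<le> small_lower_box_dim \<pi> K q \<mu>"
proof (rule scaled_le_if_rats_below_le)
  interpret prob_space \<pi> by fact
  fix t assume "ereal t < lower_D_min \<pi> K"
  from eventually_mass_less_if_lower_D_min_greater[OF K(1) this] eventually_at_right_less[of "0::real"]
  have "\<forall>\<^sub>F r in at_right 0. \<forall>x\<in>K. r powr (q * t) \<le> measure \<pi> (ball x r) powr q"
  proof eventually_elim
    case (elim r)
    have "r powr (q * t) \<le> measure \<pi> (ball x r) powr q" if "x \<in> K" for x
    proof -
      have "measure \<pi> (ball x r) \<le> r powr t"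
        using elim that by (fastforce simp: emeasure_eq_measure ennreal_less_iff)
      moreover have "0 < measure \<pi> (ball x r)"
        using measure_ball_support_pos[OF \<pi>] K(2) that elim by blast
      ultimately have "(r powr t) powr q \<le> measure \<pi> (ball x r) powr q"
        using q by (intro powr_mono2') auto
      then show ?thesis by (simp add: powr_powr mult.commute)
    qed
    then show ?case by blast
  qed
  then show "ereal (- (q * t)) \<le> small_lower_box_dim \<pi> K q \<mu>" by (rule small_lower_box_dim_ge)
qed (use q in simp)

theorem theorem1p4:
  fixes \<pi> :: "(real ^ 'd) measure" and K :: "(real ^ 'd) set"
  assumes "prob_space \<pi>" and "sets \<pi> = sets borel"
    and "K = measure_support \<pi>" and "compact K"
  shows "typically (weak_topology K) (\<lambda>\<mu>. \<forall>q::real.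
     (q \<ge> 0 \<longrightarrow>
        ereal (- q) * upper_D_max \<pi> K \<le> small_lower_box_dim \<pi> K q \<mu> \<and>
        small_lower_box_dim \<pi> K q \<mu> \<le> ereal (- q) * upper_D_unif_max \<pi> K) \<and>
     (q \<le> 0 \<longrightarrow>
        ereal (- q) * lower_D_min \<pi> K \<le> small_lower_box_dim \<pi> K q \<mu> \<and>
        small_lower_box_dim \<pi> K q \<mu> \<le> ereal (- q) * lower_D_unif_min \<pi> K))"
proof (rule coupling_residual_imp_typically[OF \<open>compact K\<close>])
  interpret prob_space \<pi> by fact
  have bounded: "bounded K" and supp: "K \<subseteq> measure_support \<pi>"
    using assms compact_imp_bounded by auto
  let ?cov = "\<lambda>P \<mu>. \<exists>E\<in>sets \<mu>. 0 < emeasure \<mu> E \<and> sparsely_coverable K P E"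
  let ?light = "\<lambda>t x r. emeasure \<pi> (ball x r) < ennreal (r powr t)"
  let ?heavy = "\<lambda>t x r. ennreal (r powr t) < emeasure \<pi> (ball x r)"
  let ?L = "{t \<in> \<rat>. ereal t < upper_D_unif_max \<pi> K}"
  let ?H = "{t \<in> \<rat>. lower_D_unif_min \<pi> K < ereal t}"
  have "coupling_residual K (\<lambda>\<mu>. ((\<forall>t\<in>?L. ?cov (?light t) \<mu>) \<and> (\<forall>t\<in>?H. ?cov (?heavy t) \<mu>)) \<and>
      ?cov (\<lambda>_ _. True) \<mu>)"
  proof (intro coupling_residual_conj coupling_residual_countable_Ball)
    show "countable ?L" "countable ?H"
      by (rule countable_subset[OF _ countable_rat], blast)+
    fix t assume "t \<in> ?L"
    then obtain z \<kappa> where "z \<in> K" "0 < \<kappa>" "attains_scales K (?light t) z \<kappa>"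
      using attains_scales_if_less_upper_D_unif_max[of t \<pi> K] by blast
    then show "coupling_residual K (?cov (?light t))"
      by (rule sparsely_coverable_residual[OF \<open>compact K\<close>])
  next
    fix t assume "t \<in> ?H"
    then obtain z \<kappa> where "z \<in> K" "0 < \<kappa>" "attains_scales K (?heavy t) z \<kappa>"
      using attains_scales_if_greater_lower_D_unif_min[of \<pi> K t] by blast
    then show "coupling_residual K (?cov (?heavy t))"
      by (rule sparsely_coverable_residual[OF \<open>compact K\<close>])
  next
    show "coupling_residual K (?cov (\<lambda>_ _. True))"
    proof (cases "K = {}")
      case True
      then have "prob_measures K = {}"
        using prob_measures_imp_nonempty by auto
      then show ?thesis unfolding coupling_residual_def by (intro exI[of _ "{}"]) simp
    next
      case False
      then obtain z where "z \<in> K" by blast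
      then show ?thesis
        by (rule sparsely_coverable_residual[OF \<open>compact K\<close> _ zero_less_one attains_scales_trivial])
    qed
  qed
  then show "coupling_residual K (\<lambda>\<mu>. \<forall>q::real.
     (q \<ge> 0 \<longrightarrow>
        ereal (- q) * upper_D_max \<pi> K \<le> small_lower_box_dim \<pi> K q \<mu> \<and>
        small_lower_box_dim \<pi> K q \<mu> \<le> ereal (- q) * upper_D_unif_max \<pi> K) \<and>
     (q \<le> 0 \<longrightarrow>
        ereal (- q) * lower_D_min \<pi> K \<le> small_lower_box_dim \<pi> K q \<mu> \<and>
        small_lower_box_dim \<pi> K q \<mu> \<le> ereal (- q) * lower_D_unif_min \<pi> K))"
  proof (rule coupling_residual_mono, elim conjE, intro allI)
    fix \<mu> and q :: real
    assume light: "\<forall>t\<in>?L. ?cov (?light t) \<mu>" and heavy: "\<forall>t\<in>?H. ?cov (?heavy t) \<mu>"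
      and triv: "?cov (\<lambda>_ _. True) \<mu>"
    \<comment> \<open>For \<open>q = 0\<close> all bounds are \<open>0\<close>, even for infinite exponents, and any sparse cover will do.\<close>
    consider "q = 0" | "q > 0" | "q < 0" by linarith
    then show "(q \<ge> 0 \<longrightarrow>
        ereal (- q) * upper_D_max \<pi> K \<le> small_lower_box_dim \<pi> K q \<mu> \<and>
        small_lower_box_dim \<pi> K q \<mu> \<le> ereal (- q) * upper_D_unif_max \<pi> K) \<and>
     (q \<le> 0 \<longrightarrow>
        ereal (- q) * lower_D_min \<pi> K \<le> small_lower_box_dim \<pi> K q \<mu> \<and>
        small_lower_box_dim \<pi> K q \<mu> \<le> ereal (- q) * lower_D_unif_min \<pi> K)"
    proof cases
      case 1
      have "small_lower_box_dim \<pi> K 0 \<mu> \<le> ereal (- 0)"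
        by (rule small_lower_box_dim_le_if_sparsely_coverable[OF triv]) simp
      then show ?thesis
        using 1 small_lower_box_dim_0_nonneg[OF \<open>prob_space \<pi>\<close> supp, of \<mu>] by (simp flip: zero_ereal_def)
    next
      case 2
      have "small_lower_box_dim \<pi> K q \<mu> \<le> ereal (- q) * upper_D_unif_max \<pi> K"
      proof (rule le_scaled_if_le_rats_below[OF 2])
        fix t assume "t \<in> \<rat>" "ereal t < upper_D_unif_max \<pi> K"
        then have "?cov (?light t) \<mu>" using light by blast
        then show "small_lower_box_dim \<pi> K q \<mu> \<le> ereal (- (q * t))"
        proof (rule small_lower_box_dim_le_if_sparsely_coverable)
          fix x and r :: real assume "emeasure \<pi> (ball x r) < ennreal (r powr t)"
          then have "measure \<pi> (ball x r) \<le> r powr t"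
            by (simp add: emeasure_eq_measure ennreal_less_iff)
          then have "measure \<pi> (ball x r) powr q \<le> (r powr t) powr q"
            using 2 by (intro powr_mono2) auto
          then show "measure \<pi> (ball x r) powr q \<le> r powr (q * t)"
            by (simp add: powr_powr mult.commute)
        qed
      qed
      then show ?thesis
        using 2 small_lower_box_dim_ge_upper_D_max[OF \<open>prob_space \<pi>\<close> bounded 2] by simp
    next
      case 3
      have "small_lower_box_dim \<pi> K q \<mu> \<le> ereal (- q) * lower_D_unif_min \<pi> K"
      proof (rule le_scaled_if_le_rats_above[OF 3])
        fix t assume "t \<in> \<rat>" "lower_D_unif_min \<pi> K < ereal t"
        then have "?cov (?heavy t) \<mu>" using heavy by blast
        then show "small_lower_box_dim \<pi> K q \<mu> \<le> ereal (- (q * t))"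
        proof (rule small_lower_box_dim_le_if_sparsely_coverable)
          fix x and r :: real assume "0 < r" "ennreal (r powr t) < emeasure \<pi> (ball x r)"
          then have "measure \<pi> (ball x r) powr q \<le> (r powr t) powr q"
            using 3 by (intro powr_mono2') (auto simp: emeasure_eq_measure ennreal_less_iff)
          then show "measure \<pi> (ball x r) powr q \<le> r powr (q * t)"
            by (simp add: powr_powr mult.commute)
        qed
      qed
      then show ?thesis
        using 3 small_lower_box_dim_ge_lower_D_min[OF \<open>prob_space \<pi>\<close> bounded supp 3] by simp
    qed
  qed
qed

end
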